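(* There is a unique $C_0>1$ such that $\frac{C_0}{2}-1-\log C_0=0$, and $C_0<8$. Moreover, fix $C>C_0$, let $\delta=\delta(C)=C-1-\log C>0$, fix $M>\frac1\delta$, and let $\alpha>0$ be such that $\delta(C)-C\left(\alpha+\frac12\right)>0$. Fix $0<\gamma<1$. Then there is a positive constant $L_4$ such that, for all $n\ge L_4$, \[ \mathbb{P}(H_3)\ge 1-e^{-\alpha C}-\gamma, \] where $H_3$ is the event that there exists a vertex $i\in\{1,\dots,n\}$ with $(1-q(C)-\gamma)n\le\#\mathcal{E}_i\le(1-q(C)+\gamma)n$ such that $\#\mathcal{E}_j\le M\log n$ for every vertex $j$ with $\mathcal{E}_j\neq\mathcal{E}_i$.
   Context: Let $C>0$ be a constant and $(\alpha_n)_{n\ge1}$ a sequence of nonnegative reals with $\alpha_n\to0$. For each $n$, consider the complete graph $K_n$ on vertex set $\{1,\dots,n\}$; each edge $e$ of $K_n$ is independently open with probability $p_n(e)$ and closed otherwise, where $\frac{C-\alpha_n}{n}\le p_n(e)\le\frac{C+\alpha_n}{n}$ for every edge $e$. Let $G$ be the resulting random graph of open edges, with probability measure $\mathbb{P}$. For a vertex $i$, $\mathcal{E}_i$ denotes the open component of $G$ containing $i$ (the set of vertices joined to $i$ by a path of open edges, together with $i$ itself), and $\#\mathcal{E}_i$ its number of vertices. $\log$ is the natural logarithm. $T_1=1$ and for $r\ge2$, $T_r$ is the number of labelled trees on $r$ vertices; $q(C)=\sum_{r=1}^\infty \frac{T_rC^{r-1}e^{-Cr}}{(r-1)!}$. 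*)

theory Defs
  imports "HOL-Probability.Probability"
begin

definition Kedges :: "nat \<Rightarrow> nat set set" where
  "Kedges n = {e. \<exists>i j. i \<in> {1..n} \<and> j \<in> {1..n} \<and> i \<noteq> j \<and> e = {i, j}}"

definition adj :: "(nat set \<Rightarrow> bool) \<Rightarrow> (nat \<times> nat) set" where
  "adj G = {(u, v). u \<noteq> v \<and> G {u, v}}"

definition comp :: "(nat set \<Rightarrow> bool) \<Rightarrow> nat \<Rightarrow> nat set" where
  "comp G i = {j. (i, j) \<in> (adj G)\<^sup>*}"

definition rgraph :: "nat \<Rightarrow> (nat set \<Rightarrow> real) \<Rightarrow> (nat set \<Rightarrow> bool) pmf" where
  "rgraph n p = Pi_pmf (Kedges n) False (\<lambda>e. bernoulli_pmf (p e))"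

definition labelled_trees :: "nat \<Rightarrow> nat" where
  "labelled_trees r = card {T. T \<subseteq> Kedges r \<and> card T = r - 1 \<and>
       (\<forall>i\<in>{1..r}. \<forall>j\<in>{1..r}. j \<in> comp (\<lambda>e. e \<in> T) i)}"

definition qC :: "real \<Rightarrow> real" where
  "qC C = (\<Sum>k. real (labelled_trees (k + 1)) * C ^ k * exp (- C * real (k + 1)) / fact k)"

definition H3 :: "nat \<Rightarrow> real \<Rightarrow> real \<Rightarrow> real \<Rightarrow> (nat set \<Rightarrow> bool) set" where
  "H3 n C M \<gamma> = {G. \<exists>i\<in>{1..n}.
      (1 - qC C - \<gamma>) * real n \<le> real (card (comp G i)) \<and>
      real (card (comp G i)) \<le> (1 - qC C + \<gamma>) * real n \<and>
      (\<forall>j\<in>{1..n}. comp G j \<noteq> comp G i \<longrightarrow> real (card (comp G j)) \<le> M * ln (real n))}"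

end

theory Submission
  imports Defs "HOL-Real_Asymp.Real_Asymp"
begin

text \<open>
  If \<open>r \<le> n / 2\<close>, a component with \<open>r\<close> vertices contains one of at most \<open>r ^ (r - 1)\<close> spanning
  trees and its \<open>r (n - r)\<close> boundary edges are closed. Hence the expected number of such components
  is at most about \<open>(n / C) exp (- r (C (1 - r / n) - 1 - ln C))\<close>. The exponent is at least
  \<open>r (C / 2 - 1 - ln C)\<close>, and it approaches \<open>r (C - 1 - ln C)\<close> when \<open>r\<close> is small compared to \<open>n\<close>; so with
  high probability no component size lies between \<open>M ln n\<close> and \<open>n / 2\<close>. For fixed \<open>r\<close>, a second
  moment computation shows that the number of components of size \<open>r\<close>, divided by \<open>n\<close>, concentrates
  at the \<open>r\<close>-th term of \<open>qC C\<close> divided by \<open>r\<close>. So about \<open>qC C * n\<close> vertices lie in small components,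
  and the others form a single component, as two disjoint sets cannot both contain more than half
  of the vertices.
\<close>

section \<open>Components, cuts and spanning trees\<close>

definition Edges :: "nat set \<Rightarrow> nat set set" where
  "Edges S = {e. \<exists>i j. i \<in> S \<and> j \<in> S \<and> i \<noteq> j \<and> e = {i, j}}"

text \<open>Connectedness with \<open>card S - 1\<close> edges characterises trees, so acyclicity is
  implied. The vertex set is arbitrary because these trees are to span components.\<close>

definition Trees :: "nat set \<Rightarrow> nat set set set" where
  "Trees S = {T. T \<subseteq> Edges S \<and> card T = card S - 1 \<and>
     (\<forall>i\<in>S. \<forall>j\<in>S. j \<in> comp (\<lambda>e. e \<in> T) i)}"

definition cutset :: "nat \<Rightarrow> nat set \<Rightarrow> nat set set" where
  "cutset n S = {e. \<exists>i\<in>S. \<exists>j\<in>{1..n} - S. e = {i, j}}"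

definition comps :: "nat \<Rightarrow> (nat set \<Rightarrow> bool) \<Rightarrow> nat set set" where
  "comps n G = comp G ` {1..n}"

lemma Kedges_eq_Edges: "Kedges n = Edges {1..n}"
  by (simp add: Kedges_def Edges_def)

lemma labelled_trees_eq: "labelled_trees r = card (Trees {1..r})"
  by (simp add: labelled_trees_def Trees_def Kedges_eq_Edges)

lemma Edges_mono: "S \<subseteq> S' \<Longrightarrow> Edges S \<subseteq> Edges S'"
  by (auto simp: Edges_def)

lemma Edges_subset_image: "Edges S \<subseteq> (\<lambda>(i, j). {i, j}) ` (S \<times> S)"
  by (auto simp: Edges_def)

lemma finite_Edges [simp]: "finite S \<Longrightarrow> finite (Edges S)"
  using Edges_subset_image by (rule finite_subset) auto

lemma card_Edges_le:
  assumes "finite S" shows "card (Edges S) \<le> card S * card S"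
  using surj_card_le[OF _ Edges_subset_image[of S]] assms by (simp add: card_cartesian_product)

lemma finite_Trees [simp]: "finite S \<Longrightarrow> finite (Trees S)"
  by (rule finite_subset[of _ "Pow (Edges S)"]) (auto simp: Trees_def)

section \<open>Connectivity, components and cuts\<close>

lemma adj_sym: "(u, v) \<in> adj G \<Longrightarrow> (v, u) \<in> adj G"
  by (auto simp: adj_def insert_commute)

lemma comp_sym: "j \<in> comp G i \<Longrightarrow> i \<in> comp G j"
proof -
  have "sym (adj G)" by (auto intro: symI adj_sym)
  then show "j \<in> comp G i \<Longrightarrow> i \<in> comp G j"
    using sym_rtrancl by (auto simp: comp_def dest: symD)
qed

lemma comp_trans: "j \<in> comp G i \<Longrightarrow> k \<in> comp G j \<Longrightarrow> k \<in> comp G i"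
  by (auto simp: comp_def)

lemma comp_self [simp]: "i \<in> comp G i"
  by (simp add: comp_def)

lemma comp_eqI: "j \<in> comp G i \<Longrightarrow> comp G j = comp G i"
  using comp_sym comp_trans by blast

lemma comp_mono: "(\<And>e. G e \<Longrightarrow> G' e) \<Longrightarrow> comp G i \<subseteq> comp G' i"
proof -
  assume "\<And>e. G e \<Longrightarrow> G' e"
  then have "adj G \<subseteq> adj G'" by (auto simp: adj_def)
  then show ?thesis using rtrancl_mono by (auto simp: comp_def)
qed

lemma comp_subset_closed:
  assumes "i \<in> S" and "\<And>u v. u \<in> S \<Longrightarrow> v \<notin> S \<Longrightarrow> \<not> G {u, v}"
  shows "comp G i \<subseteq> S"
proof
  fix j assume "j \<in> comp G i"
  then have "(i, j) \<in> (adj G)\<^sup>*" by (simp add: comp_def)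
  then show "j \<in> S"
    by induction (use assms in \<open>auto simp: adj_def\<close>)
qed

lemma comps_disjoint:
  assumes "S \<in> comps n G" "S' \<in> comps n G" "S \<noteq> S'"
  shows "S \<inter> S' = {}"
proof (rule ccontr)
  assume "S \<inter> S' \<noteq> {}"
  then obtain k where "k \<in> S" "k \<in> S'" by auto
  then have "comp G k = S" "comp G k = S'"
    using assms comp_eqI by (auto simp: comps_def)
  with assms(3) show False by simp
qed

lemma finite_comps [simp]: "finite (comps n G)"
  by (simp add: comps_def)

lemma card_comps_le: "card (comps n G) \<le> n"
  unfolding comps_def using card_image_le[of "{1..n}" "comp G"] by simp

lemma cutset_eq_image: "cutset n S = (\<lambda>(i, j). {i, j}) ` (S \<times> ({1..n} - S))"
  by (auto simp: cutset_def)

lemma finite_cutset [simp]: "finite S \<Longrightarrow> finite (cutset n S)"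
  by (simp add: cutset_eq_image)

lemma card_cutset:
  assumes "S \<subseteq> {1..n}" shows "card (cutset n S) = card S * (n - card S)"
proof -
  have "inj_on (\<lambda>(i, j). {i, j}) (S \<times> ({1..n} - S))"
    by (auto simp: inj_on_def doubleton_eq_iff)
  then have "card (cutset n S) = card (S \<times> ({1..n} - S))"
    unfolding cutset_eq_image by (rule card_image)
  also have "\<dots> = card S * (n - card S)"
    using assms finite_subset[OF assms] by (simp add: card_cartesian_product card_Diff_subset)
  finally show ?thesis .
qed

lemma cutset_subset_Kedges: "S \<subseteq> {1..n} \<Longrightarrow> cutset n S \<subseteq> Kedges n"
proof
  fix e assume S: "S \<subseteq> {1..n}" and "e \<in> cutset n S"
  then obtain i j where "i \<in> S" "j \<in> {1..n} - S" "e = {i, j}" by (auto simp: cutset_def)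
  then show "e \<in> Kedges n" using S unfolding Kedges_def by blast
qed

lemma cutset_Edges_disjoint: "cutset n S \<inter> Edges S = {}"
  by (auto simp: cutset_def Edges_def doubleton_eq_iff)

lemma cutset_Edges_disjoint': "S \<inter> S' = {} \<Longrightarrow> cutset n S \<inter> Edges S' = {}"
  by (auto simp: cutset_def Edges_def doubleton_eq_iff)

lemma Edges_disjoint: "S \<inter> S' = {} \<Longrightarrow> Edges S \<inter> Edges S' = {}"
  by (auto simp: Edges_def doubleton_eq_iff)

text \<open>An edge in both cuts joins \<open>S\<close> to \<open>S'\<close>, so at most
  \<open>r * r\<close> edges are shared. This counts the edges that two disjoint components force to
  be closed.\<close>

lemma card_cutset_Un_ge:
  assumes "S \<subseteq> {1..n}" "S' \<subseteq> {1..n}" "S \<inter> S' = {}" "card S = r" "card S' = r"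
  shows "card (cutset n S \<union> cutset n S') \<ge> 2 * (r * (n - r)) - r * r"
proof -
  have fin: "finite S" "finite S'" using assms finite_subset by blast+
  have "cutset n S \<inter> cutset n S' \<subseteq> (\<lambda>(i, j). {i, j}) ` (S \<times> S')"
  proof
    fix e assume "e \<in> cutset n S \<inter> cutset n S'"
    then obtain i j i' j' where *: "i \<in> S" "j \<notin> S" "e = {i, j}" "i' \<in> S'" "j' \<notin> S'" "e = {i', j'}"
      unfolding cutset_def by blast
    then have "i \<noteq> i'" using assms(3) by blast
    then have "e = {i, i'}" using * by (auto simp: doubleton_eq_iff)
    then show "e \<in> (\<lambda>(i, j). {i, j}) ` (S \<times> S')" using * by auto
  qed
  then have "card (cutset n S \<inter> cutset n S') \<le> card (S \<times> S')"
    using fin by (intro surj_card_le) auto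
  also have "\<dots> = r * r" using assms by (simp add: card_cartesian_product)
  finally have "card (cutset n S \<inter> cutset n S') \<le> r * r" .
  moreover have "card (cutset n S \<union> cutset n S') + card (cutset n S \<inter> cutset n S') = card (cutset n S) + card (cutset n S')"
    using fin by (intro card_Un_Int[symmetric]) auto
  ultimately show ?thesis using assms by (simp add: card_cutset)
qed

text \<open>Sending each vertex to a neighbour closer to the root \<open>s\<close> yields a spanning tree, and
  conversely recovers every tree on \<open>S\<close>; hence there are at most \<open>r ^ (r - 1)\<close> trees.\<close>

lemma parent_function:
  assumes "finite S" "s \<in> S" "H \<subseteq> Edges S" "\<And>v. v \<in> S \<Longrightarrow> v \<in> comp (\<lambda>e. e \<in> H) s"
  obtains f where "f \<in> (S - {s}) \<rightarrow>\<^sub>E S" "(\<lambda>v. {v, f v}) ` (S - {s}) \<subseteq> H"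
    "inj_on (\<lambda>v. {v, f v}) (S - {s})"
    "\<And>v. v \<in> S \<Longrightarrow> v \<in> comp (\<lambda>e. e \<in> (\<lambda>v. {v, f v}) ` (S - {s})) s"
proof -
  let ?A = "adj (\<lambda>e. e \<in> H)"
  \<comment> \<open>\<open>d v\<close> is the graph distance from the root, well defined on
    \<open>S\<close> by connectivity.\<close>
  define d where "d v = (LEAST k. (s, v) \<in> ?A ^^ k)" for v
  have reach: "(s, v) \<in> ?A ^^ d v" if v: "v \<in> S" for v
  proof -
    have "\<exists>k. (s, v) \<in> ?A ^^ k"
      using assms(4)[OF v] by (auto simp: comp_def rtrancl_is_UN_relpow)
    then show ?thesis unfolding d_def by (rule LeastI_ex)
  qed
  have "\<exists>w. w \<in> S \<and> {v, w} \<in> H \<and> d w < d v" if v: "v \<in> S - {s}" for v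
  proof -
    have "d v \<noteq> 0"
    proof
      assume "d v = 0"
      with reach[of v] v show False by auto
    qed
    then obtain k where k: "d v = Suc k" by (cases "d v") auto
    \<comment> \<open>The predecessor of \<open>v\<close> on a shortest path is one step closer to
      the root.\<close>
    have "(s, v) \<in> ?A ^^ Suc k" using reach[of v] v k by auto
    then obtain w where w: "(s, w) \<in> ?A ^^ k" "(w, v) \<in> ?A" by auto
    from w(2) have H: "{v, w} \<in> H" by (auto simp: adj_def insert_commute)
    moreover from H assms(3) have "w \<in> S" by (auto simp: Edges_def doubleton_eq_iff)
    moreover have "d w \<le> k" unfolding d_def using w(1) by (rule Least_le)
    ultimately show ?thesis using k by auto
  qed
  then obtain g where g: "\<And>v. v \<in> S - {s} \<Longrightarrow> g v \<in> S \<and> {v, g v} \<in> H \<and> d (g v) < d v"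
    by metis
  \<comment> \<open>Restriction makes \<open>f\<close> extensional, so that the parent functions lie
    in a \<open>PiE\<close> set of known size.\<close>
  define f where "f = restrict g (S - {s})"
  have f: "f v \<in> S" "{v, f v} \<in> H" "d (f v) < d v" if "v \<in> S - {s}" for v
    using g[OF that] that by (auto simp: f_def)
  show ?thesis
  proof (rule that)
    show "f \<in> (S - {s}) \<rightarrow>\<^sub>E S" using f(1) by (auto simp: f_def)
    show "(\<lambda>v. {v, f v}) ` (S - {s}) \<subseteq> H" using f(2) by blast
    show "inj_on (\<lambda>v. {v, f v}) (S - {s})"
    proof (rule inj_onI)
      fix x y assume xy: "x \<in> S - {s}" "y \<in> S - {s}" "{x, f x} = {y, f y}"
      show "x = y"
      proof (rule ccontr)
        assume "x \<noteq> y"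
        \<comment> \<open>Distinct vertices sharing an edge would be parents of each other, each
          strictly closer to the root than the other.\<close>
        then have "f x = y" "f y = x" using xy(3) by (auto simp: doubleton_eq_iff)
        then show False using f(3)[OF xy(1)] f(3)[OF xy(2)] by simp
      qed
    qed
    show "v \<in> comp (\<lambda>e. e \<in> (\<lambda>v. {v, f v}) ` (S - {s})) s" if "v \<in> S" for v
      using that
    proof (induction "d v" arbitrary: v rule: less_induct)
      case less
      show ?case
      proof (cases "v = s")
        case False
        then have v: "v \<in> S - {s}" using less by auto
        have "(f v, v) \<in> adj (\<lambda>e. e \<in> (\<lambda>v. {v, f v}) ` (S - {s}))"
          using v f(3)[OF v] by (auto simp: adj_def insert_commute)
        then show ?thesis
          using less(1)[OF f(3)[OF v] f(1)[OF v]] by (auto simp: comp_def)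
      qed simp
    qed
  qed
qed

text \<open>The parent edges lie in \<open>H\<close>, number \<open>card S - 1\<close> by
  injectivity, and connect every vertex to the root, hence any two vertices through it.\<close>

lemma connected_imp_tree:
  assumes "finite S" "S \<noteq> {}" "H \<subseteq> Edges S"
    and conn: "\<And>i j. i \<in> S \<Longrightarrow> j \<in> S \<Longrightarrow> j \<in> comp (\<lambda>e. e \<in> H) i"
  shows "\<exists>T\<in>Trees S. T \<subseteq> H"
proof -
  obtain s where s: "s \<in> S" using assms(2) by auto
  obtain f where "f \<in> (S - {s}) \<rightarrow>\<^sub>E S" and f: "(\<lambda>v. {v, f v}) ` (S - {s}) \<subseteq> H" "inj_on (\<lambda>v. {v, f v}) (S - {s})"
    "\<And>v. v \<in> S \<Longrightarrow> v \<in> comp (\<lambda>e. e \<in> (\<lambda>v. {v, f v}) ` (S - {s})) s"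
    by (rule parent_function[OF assms(1) s assms(3) conn[OF s]], assumption, rule that)
  let ?T = "(\<lambda>v. {v, f v}) ` (S - {s})"
  have "card ?T = card S - 1"
    using card_image[OF f(2)] s assms(1) by simp
  moreover have "j \<in> comp (\<lambda>e. e \<in> ?T) i" if "i \<in> S" "j \<in> S" for i j
    using comp_sym[OF f(3)[OF that(1)]] f(3)[OF that(2)] by (rule comp_trans)
  ultimately have "?T \<in> Trees S"
    using f(1) assms(3) unfolding Trees_def by blast
  with f(1) show ?thesis by blast
qed

lemma labelled_trees_le: "labelled_trees r \<le> r ^ (r - 1)"
proof (cases "r = 0")
  case True
  \<comment> \<open>Truncated subtraction makes the bound \<open>0 ^ 0 = 1\<close>, and the empty
    edge set is the only candidate.\<close>
  have "labelled_trees r \<le> card {{} :: nat set set}"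
    unfolding labelled_trees_eq by (rule card_mono) (auto simp: Trees_def Edges_def True)
  with True show ?thesis by simp
next
  case False
  let ?S = "{1..r}" and ?F = "({1..r} - {1}) \<rightarrow>\<^sub>E {1..r}"
  have one: "(1::nat) \<in> ?S" using False by auto
  have sub: "Trees ?S \<subseteq> (\<lambda>f. (\<lambda>v. {v, f v}) ` (?S - {1})) ` ?F"
  proof
    fix T assume T: "T \<in> Trees ?S"
    then have T': "T \<subseteq> Edges ?S" "\<And>v. v \<in> ?S \<Longrightarrow> v \<in> comp (\<lambda>e. e \<in> T) 1"
      using one by (auto simp: Trees_def)
    obtain f where f: "f \<in> ?F" "(\<lambda>v. {v, f v}) ` (?S - {1}) \<subseteq> T"
      "inj_on (\<lambda>v. {v, f v}) (?S - {1})"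
      by (rule parent_function[OF _ one T'], simp, assumption, rule that)
    \<comment> \<open>The parent edges form a subset of \<open>T\<close> with as many elements,
      hence all of \<open>T\<close>: a tree is recovered from its parent function.\<close>
    have "card T = card ((\<lambda>v. {v, f v}) ` (?S - {1}))"
      using T card_image[OF f(3)] one by (simp add: Trees_def)
    moreover have "finite T" using T' finite_subset by (metis finite_Edges finite_atLeastAtMost)
    ultimately have "(\<lambda>v. {v, f v}) ` (?S - {1}) = T"
      using card_subset_eq[OF _ f(2)] by simp
    with f(1) show "T \<in> (\<lambda>f. (\<lambda>v. {v, f v}) ` (?S - {1})) ` ?F" by blast
  qed
  have "labelled_trees r \<le> card ?F"
    unfolding labelled_trees_eq by (rule surj_card_le[OF _ sub]) (simp add: finite_PiE)
  also have "\<dots> = r ^ (r - 1)"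
    using one by (simp add: card_PiE)
  finally show ?thesis .
qed

text \<open>A relabelling of the vertices carries trees to trees injectively. The inverse bijection
  supplies the opposite inequality in \<open>card_Trees\<close>.\<close>

lemma card_Trees_le_of_bij:
  assumes "finite S" "finite S'" and h: "bij_betw h S S'"
  shows "card (Trees S) \<le> card (Trees S')"
proof (rule card_inj_on_le)
  have inj: "inj_on h S" and img: "h ` S = S'"
    using h by (auto simp: bij_betw_def)
  \<comment> \<open>Trees are sets of edges and edges are sets of vertices, so injectivity is lifted
    through two image operators.\<close>
  have inj2: "inj_on ((`) h) (Pow S)" using inj by (rule inj_on_image_Pow)
  have E: "Edges S \<subseteq> Pow S" by (auto simp: Edges_def)
  have "inj_on ((`) ((`) h)) (Pow (Pow S))" using inj2 by (rule inj_on_image_Pow)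
  then show "inj_on ((`) ((`) h)) (Trees S)"
    by (rule inj_on_subset) (use E in \<open>auto simp: Trees_def\<close>)
  show "finite (Trees S')" using assms by simp
  show "(`) ((`) h) ` Trees S \<subseteq> Trees S'"
  proof
    fix T' assume "T' \<in> (`) ((`) h) ` Trees S"
    then obtain T where T: "T \<in> Trees S" "T' = (`) h ` T" by auto
    have TE: "T \<subseteq> Edges S" using T by (auto simp: Trees_def)
    have hE: "h ` e \<in> Edges S'" if "e \<in> Edges S" for e
    proof -
      from that obtain i j where "i \<in> S" "j \<in> S" "i \<noteq> j" "e = {i, j}"
        by (auto simp: Edges_def)
      then show ?thesis using inj img unfolding Edges_def
        by (intro CollectI exI[of _ "h i"] exI[of _ "h j"]) (auto dest: inj_onD)
    qed
    have "card T' = card T"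
      unfolding T(2) by (rule card_image, rule inj_on_subset[OF inj2]) (use TE E in auto)
    also have "\<dots> = card S' - 1"
      using T bij_betw_same_card[OF h] by (simp add: Trees_def)
    finally have "card T' = card S' - 1" .
    moreover have "h j \<in> comp (\<lambda>e. e \<in> T') (h i)" if "i \<in> S" "j \<in> S" for i j
    proof -
      have "(i, j) \<in> (adj (\<lambda>e. e \<in> T))\<^sup>*" using T that by (auto simp: Trees_def comp_def)
      then have "(h i, h j) \<in> (adj (\<lambda>e. e \<in> T'))\<^sup>*"
      proof induction
        case (step y z)
        then have yz: "{y, z} \<in> T" "y \<noteq> z" by (auto simp: adj_def)
        then have "y \<in> S" "z \<in> S" using TE E by blast+
        then have "h y \<noteq> h z" using inj yz by (auto dest: inj_onD)
        moreover have "h ` {y, z} \<in> T'" using yz T(2) by blast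
        ultimately have "(h y, h z) \<in> adj (\<lambda>e. e \<in> T')" by (simp add: adj_def)
        with step show ?case by simp
      qed simp
      then show ?thesis by (simp add: comp_def)
    qed
    ultimately show "T' \<in> Trees S'"
      using TE hE T(2) unfolding Trees_def img[symmetric] by blast
  qed
qed

lemma card_Trees:
  assumes "finite S" shows "card (Trees S) = labelled_trees (card S)"
proof -
  obtain h where h: "bij_betw h S {1..card S}"
    using assms by (metis card_atLeastAtMost diff_Suc_1 finite_atLeastAtMost finite_same_card_bij)
  show ?thesis unfolding labelled_trees_eq
    using card_Trees_le_of_bij[OF _ _ h] card_Trees_le_of_bij[OF _ _ bij_betw_inv_into[OF h]] assms
    by (simp add: le_antisym)
qed

section \<open>Components as an open spanning tree with a closed cut\<close>

lemma comp_subset_vertices: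
  assumes "\<And>e. G e \<Longrightarrow> e \<in> Kedges n" "i \<in> {1..n}"
  shows "comp G i \<subseteq> {1..n}"
  using assms(2)
proof (rule comp_subset_closed)
  show "\<not> G {u, v}" if "u \<in> {1..n}" "v \<notin> {1..n}" for u v
    using assms(1)[of "{u, v}"] that unfolding Kedges_def by (auto simp: doubleton_eq_iff)
qed

text \<open>Together with the converse \<open>tree_and_cutset_imp_comps\<close>, this turns being a
  component into conditions on disjoint sets of edges, whose probabilities are products.\<close>

lemma comps_imp_tree_and_cutset:
  assumes "S \<in> comps n G" "\<And>e. G e \<Longrightarrow> e \<in> Kedges n"
  shows "\<exists>T\<in>Trees S. \<forall>e\<in>T. G e" and "\<forall>e\<in>cutset n S. \<not> G e"
proof -
  obtain s where s: "s \<in> {1..n}" "S = comp G s" using assms(1) by (auto simp: comps_def)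
  have "S \<subseteq> {1..n}" using comp_subset_vertices[OF assms(2) s(1)] s(2) by simp
  then have fin: "finite S" using finite_subset by blast
  \<comment> \<open>A path from \<open>s\<close> never leaves the component of \<open>s\<close>, so
    the open edges inside \<open>S\<close> already connect it.\<close>
  define H where "H = {e \<in> Edges S. G e}"
  have reach: "v \<in> comp (\<lambda>e. e \<in> H) s" if "v \<in> S" for v
  proof -
    have "(s, v) \<in> (adj G)\<^sup>*" using that s by (simp add: comp_def)
    then show ?thesis
    proof induction
      case (step y z)
      then have "y \<in> S" "z \<in> S" using s by (auto simp: comp_def)
      moreover have "y \<noteq> z" "G {y, z}" using step by (auto simp: adj_def)
      ultimately have "(y, z) \<in> adj (\<lambda>e. e \<in> H)" unfolding adj_def H_def Edges_def by blast
      with step show ?case by (auto simp: comp_def)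
    qed simp
  qed
  have "\<exists>T\<in>Trees S. T \<subseteq> H"
  proof (rule connected_imp_tree[OF fin])
    show "S \<noteq> {}" using s comp_self by blast
    show "H \<subseteq> Edges S" by (auto simp: H_def)
    show "j \<in> comp (\<lambda>e. e \<in> H) i" if "i \<in> S" "j \<in> S" for i j
      using comp_trans[OF comp_sym[OF reach] reach] that by blast
  qed
  then show "\<exists>T\<in>Trees S. \<forall>e\<in>T. G e" by (auto simp: H_def)
  show "\<forall>e\<in>cutset n S. \<not> G e"
  proof
    fix e assume "e \<in> cutset n S"
    then obtain i j where ij: "i \<in> S" "j \<notin> S" "e = {i, j}" by (auto simp: cutset_def)
    show "\<not> G e"
    proof
      assume "G e"
      then have "(i, j) \<in> adj G" using ij by (auto simp: adj_def)
      then have "j \<in> S" using ij(1) unfolding s(2) comp_def by (auto intro: rtrancl_into_rtrancl)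
      with ij show False by simp
    qed
  qed
qed

text \<open>The open tree puts \<open>S\<close> inside one component, and the closed cut keeps that
  component inside \<open>S\<close>.\<close>

lemma tree_and_cutset_imp_comps:
  assumes "S \<noteq> {}" "S \<subseteq> {1..n}" "T \<in> Trees S" "\<And>e. G e \<Longrightarrow> e \<in> Kedges n"
    and "\<And>e. e \<in> T \<Longrightarrow> G e" "\<And>e. e \<in> cutset n S \<Longrightarrow> \<not> G e"
  shows "S \<in> comps n G"
proof -
  obtain s where s: "s \<in> S" using assms(1) by auto
  have "S \<subseteq> comp (\<lambda>e. e \<in> T) s" using s assms(3) by (auto simp: Trees_def)
  also have "\<dots> \<subseteq> comp G s" using assms(5) by (rule comp_mono)
  finally have "S \<subseteq> comp G s" .
  moreover have "comp G s \<subseteq> S"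
    using s
  proof (rule comp_subset_closed)
    fix u v assume uv: "u \<in> S" "v \<notin> S"
    show "\<not> G {u, v}"
    proof (cases "v \<in> {1..n}")
      case True
      then have "{u, v} \<in> cutset n S" using uv unfolding cutset_def by blast
      with assms(6) show ?thesis by blast
    next
      case False
      then have "{u, v} \<notin> Kedges n" by (auto simp: Kedges_def doubleton_eq_iff)
      with assms(4) show ?thesis by blast
    qed
  qed
  ultimately have "S = comp G s" by blast
  moreover have "s \<in> {1..n}" using s assms(2) by blast
  ultimately show ?thesis unfolding comps_def by (rule image_eqI)
qed

section \<open>Moments of the number of components of a given size\<close>

definition vsets :: "nat \<Rightarrow> nat \<Rightarrow> nat set set" where
  "vsets n r = {S. S \<subseteq> {1..n} \<and> card S = r}"

definition num_comps :: "nat \<Rightarrow> nat \<Rightarrow> (nat set \<Rightarrow> bool) \<Rightarrow> nat" where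
  "num_comps n r G = card {S \<in> comps n G. card S = r}"

lemma finite_vsets [simp]: "finite (vsets n r)"
  by (rule finite_subset[of _ "Pow {1..n}"]) (auto simp: vsets_def)

lemma card_vsets: "card (vsets n r) = n choose r"
  unfolding vsets_def using n_subsets[of "{1..n}" r] by simp

lemma num_comps_le: "num_comps n r G \<le> n"
proof -
  have "num_comps n r G \<le> card (comps n G)"
    unfolding num_comps_def by (rule card_mono) auto
  with card_comps_le show ?thesis by (rule order_trans[rotated])
qed

section \<open>Cylinder events and the support of the random graph\<close>

lemma finite_Kedges [simp]: "finite (Kedges n)"
  by (simp add: Kedges_eq_Edges)

lemma prob_cylinder:
  assumes "A \<subseteq> Kedges n" "B \<subseteq> Kedges n" "A \<inter> B = {}"
    and p: "\<And>e. e \<in> Kedges n \<Longrightarrow> 0 \<le> p e \<and> p e \<le> 1"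
  shows "measure_pmf.prob (rgraph n p) {G. (\<forall>e\<in>A. G e) \<and> (\<forall>e\<in>B. \<not> G e)} =
    (\<Prod>e\<in>A. p e) * (\<Prod>e\<in>B. 1 - p e)"
proof -
  \<comment> \<open>The event is a product set: each edge is confined to \<open>{True}\<close> or
    \<open>{False}\<close> or left free, and disjointness of \<open>A\<close> and \<open>B\<close>
    makes the choice consistent.\<close>
  let ?X = "\<lambda>e. if e \<in> A then {True} else if e \<in> B then {False} else UNIV"
  have "{G. (\<forall>e\<in>A. G e) \<and> (\<forall>e\<in>B. \<not> G e)} = Pi (Kedges n) ?X"
    (is "?L = ?R")
  proof (intro equalityI subsetI)
    fix G assume "G \<in> ?L" then show "G \<in> ?R" by (auto simp: Pi_def)
  next
    fix G assume G: "G \<in> ?R"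
    have "G e" if "e \<in> A" for e
      using Pi_mem[OF G, of e] that assms(1) by auto
    moreover have "\<not> G e" if "e \<in> B" for e
    proof -
      have "e \<notin> A" "e \<in> Kedges n" using that assms(2,3) by auto
      then show ?thesis using Pi_mem[OF G, of e] that by simp
    qed
    ultimately show "G \<in> ?L" by blast
  qed
  then have "measure_pmf.prob (rgraph n p) {G. (\<forall>e\<in>A. G e) \<and> (\<forall>e\<in>B. \<not> G e)} =
      (\<Prod>e\<in>Kedges n. measure_pmf.prob (bernoulli_pmf (p e)) (?X e))"
    unfolding rgraph_def by (simp add: measure_Pi_pmf_Pi)
  also have "\<dots> = (\<Prod>e\<in>Kedges n. (if e \<in> A then p e else 1) * (if e \<in> B then 1 - p e else 1))"
  proof (rule prod.cong[OF refl])
    fix e assume e: "e \<in> Kedges n"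
    show "measure_pmf.prob (bernoulli_pmf (p e)) (?X e) =
        (if e \<in> A then p e else 1) * (if e \<in> B then 1 - p e else 1)"
      using assms(3) p[OF e] by (auto simp: measure_pmf_single)
  qed
  also have "\<dots> = (\<Prod>e\<in>Kedges n \<inter> A. p e) * (\<Prod>e\<in>Kedges n \<inter> B. 1 - p e)"
    by (simp add: prod.distrib prod.inter_restrict)
  finally show ?thesis using assms(1,2) by (simp add: Int_absorb1)
qed

lemma rgraph_support: "G \<in> set_pmf (rgraph n p) \<Longrightarrow> G e \<Longrightarrow> e \<in> Kedges n"
  using set_Pi_pmf_subset[OF finite_Kedges, of n False] unfolding rgraph_def by blast

text \<open>A graph in the support is determined by its open edges, a subset of the finite set
  \<open>Kedges n\<close>. Every real function of the graph is therefore integrable.\<close>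

lemma finite_set_rgraph [simp]: "finite (set_pmf (rgraph n p))"
proof (rule finite_subset)
  show "set_pmf (rgraph n p) \<subseteq> (\<lambda>E e. e \<in> E) ` Pow (Kedges n)"
  proof
    fix G assume "G \<in> set_pmf (rgraph n p)"
    then have "G = (\<lambda>e. e \<in> {e. G e})" "{e. G e} \<in> Pow (Kedges n)"
      using rgraph_support by auto
    then show "G \<in> (\<lambda>E e. e \<in> E) ` Pow (Kedges n)" by (rule image_eqI)
  qed
qed simp

lemma integrable_rgraph [simp]: "integrable (measure_pmf (rgraph n p)) (f :: _ \<Rightarrow> real)"
  by (rule integrable_measure_pmf_finite) simp

text \<open>Components are known to stay inside \<open>{1..n}\<close> only for graphs in the
  support, so inclusions of events are verified there only.\<close>

lemma prob_mono_support:
  assumes "\<And>x. x \<in> set_pmf M \<Longrightarrow> x \<in> A \<Longrightarrow> x \<in> B"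
  shows "measure_pmf.prob M A \<le> measure_pmf.prob M B"
  by (rule measure_pmf.finite_measure_mono_AE) (auto simp: AE_measure_pmf_iff assms)

lemma num_comps_eq_sum:
  assumes "G \<in> set_pmf (rgraph n p)"
  shows "real (num_comps n r G) = (\<Sum>S\<in>vsets n r. indicator {G. S \<in> comps n G} G)"
proof -
  have "S \<subseteq> {1..n}" if "S \<in> comps n G" for S
    using that comp_subset_vertices[OF rgraph_support[OF assms]] unfolding comps_def by blast
  then have "{S \<in> comps n G. card S = r} = vsets n r \<inter> {S. S \<in> comps n G}"
    unfolding vsets_def by blast
  then show ?thesis
    unfolding num_comps_def by (simp add: indicator_def sum.If_cases)
qed

section \<open>Probabilities at fixed \<open>n\<close> from uniform bounds on the edge
  probabilities\<close>

locale edge_bounds =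
  fixes n :: nat and p :: "nat set \<Rightarrow> real" and lo hi :: real
  assumes lo_nonneg: "0 \<le> lo" and lo_le_hi: "lo \<le> hi" and hi_le_1: "hi \<le> 1"
    and bounds: "\<And>e. e \<in> Kedges n \<Longrightarrow> lo \<le> p e \<and> p e \<le> hi"
begin

abbreviation "P \<equiv> measure_pmf.prob (rgraph n p)"
abbreviation "E \<equiv> measure_pmf.expectation (rgraph n p)"

lemma prob_cylinder':
  assumes "A \<subseteq> Kedges n" "B \<subseteq> Kedges n" "A \<inter> B = {}"
  shows "P {G. (\<forall>e\<in>A. G e) \<and> (\<forall>e\<in>B. \<not> G e)} = (\<Prod>e\<in>A. p e) * (\<Prod>e\<in>B. 1 - p e)"
  using assms by (rule prob_cylinder) (use bounds lo_nonneg hi_le_1 in force)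

lemma prob_cylinder_le:
  assumes "A \<subseteq> Kedges n" "B \<subseteq> Kedges n" "A \<inter> B = {}"
  shows "P {G. (\<forall>e\<in>A. G e) \<and> (\<forall>e\<in>B. \<not> G e)} \<le> hi ^ card A * (1 - lo) ^ card B"
proof -
  have b: "0 \<le> p e" "p e \<le> hi" "0 \<le> 1 - p e" "1 - p e \<le> 1 - lo" if "e \<in> Kedges n" for e
    using bounds[OF that] lo_nonneg hi_le_1 by auto
  have "(\<Prod>e\<in>A. p e) \<le> (\<Prod>e\<in>A. hi)" "(\<Prod>e\<in>B. 1 - p e) \<le> (\<Prod>e\<in>B. 1 - lo)"
    by (rule prod_mono, use assms b in blast)+
  moreover have "0 \<le> (\<Prod>e\<in>B. 1 - p e)" "0 \<le> (\<Prod>e\<in>A. hi)"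
    using assms b lo_nonneg lo_le_hi by (auto intro!: prod_nonneg)
  ultimately show ?thesis
    unfolding prob_cylinder'[OF assms] by (simp add: mult_mono)
qed

lemma prob_cylinder_ge:
  assumes "A \<subseteq> Kedges n" "B \<subseteq> Kedges n" "A \<inter> B = {}"
  shows "lo ^ card A * (1 - hi) ^ card B \<le> P {G. (\<forall>e\<in>A. G e) \<and> (\<forall>e\<in>B. \<not> G e)}"
proof -
  have b: "0 \<le> p e" "lo \<le> p e" "0 \<le> 1 - p e" "1 - hi \<le> 1 - p e" if "e \<in> Kedges n" for e
    using bounds[OF that] lo_nonneg hi_le_1 by auto
  have "(\<Prod>e\<in>A. lo) \<le> (\<Prod>e\<in>A. p e)" "(\<Prod>e\<in>B. 1 - hi) \<le> (\<Prod>e\<in>B. 1 - p e)"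
    by (rule prod_mono, use assms b lo_nonneg hi_le_1 in force)+
  moreover have "0 \<le> (\<Prod>e\<in>B. 1 - hi)" "0 \<le> (\<Prod>e\<in>A. p e)"
    using assms b hi_le_1 by (auto intro!: prod_nonneg)
  ultimately show ?thesis
    unfolding prob_cylinder'[OF assms] by (simp add: mult_mono)
qed

lemma Trees_subset_Kedges: "S \<in> vsets n r \<Longrightarrow> T \<in> Trees S \<Longrightarrow> T \<subseteq> Kedges n"
  using Edges_mono[of S "{1..n}"] by (auto simp: vsets_def Trees_def Kedges_eq_Edges)

lemma vsetsD:
  assumes "S \<in> vsets n r"
  shows "S \<subseteq> {1..n}" "card S = r" "finite S" "r \<le> n"
  using assms finite_subset[of S "{1..n}"] card_mono[of "{1..n}" S] by (auto simp: vsets_def)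

text \<open>Union bound over the spanning trees that may be open, all sharing the same closed
  cut.\<close>

lemma prob_comp_le:
  assumes S: "S \<in> vsets n r"
  shows "P {G. S \<in> comps n G} \<le> labelled_trees r * hi ^ (r - 1) * (1 - lo) ^ (r * (n - r))"
proof -
  note S' = vsetsD[OF S]
  let ?C = "\<lambda>T. {G. (\<forall>e\<in>T. G e) \<and> (\<forall>e\<in>cutset n S. \<not> G e)}"
  have "P {G. S \<in> comps n G} \<le> P (\<Union>T\<in>Trees S. ?C T)"
  proof (rule prob_mono_support)
    fix G assume G: "G \<in> set_pmf (rgraph n p)" "G \<in> {G. S \<in> comps n G}"
    show "G \<in> (\<Union>T\<in>Trees S. ?C T)"
      using comps_imp_tree_and_cutset[of S n G] rgraph_support[OF G(1)] G(2) by blast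
  qed
  also have "\<dots> \<le> (\<Sum>T\<in>Trees S. P (?C T))"
    using S' by (intro measure_pmf.finite_measure_subadditive_finite) auto
  also have "\<dots> \<le> (\<Sum>T\<in>Trees S. hi ^ (r - 1) * (1 - lo) ^ (r * (n - r)))"
  proof (rule sum_mono)
    fix T assume T: "T \<in> Trees S"
    have "P (?C T) \<le> hi ^ card T * (1 - lo) ^ card (cutset n S)"
      using Trees_subset_Kedges[OF S T] cutset_subset_Kedges[OF S'(1)] cutset_Edges_disjoint[of n S] T
      by (intro prob_cylinder_le) (auto simp: Trees_def)
    then show "P (?C T) \<le> hi ^ (r - 1) * (1 - lo) ^ (r * (n - r))"
      using T S' by (simp add: card_cutset Trees_def)
  qed
  finally show ?thesis using S' by (simp add: card_Trees mult.assoc)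
qed

text \<open>Union bound over pairs of spanning trees if \<open>S\<close> and \<open>Z\<close> are
  disjoint; distinct overlapping sets are never both components.\<close>

lemma prob_two_comps_le:
  assumes S: "S \<in> vsets n r" and Z: "Z \<in> vsets n r" and "S \<noteq> Z"
  shows "P {G. S \<in> comps n G \<and> Z \<in> comps n G} \<le>
    (labelled_trees r * hi ^ (r - 1))\<^sup>2 * (1 - lo) ^ (2 * (r * (n - r)) - r * r)" (is "_ \<le> ?B")
proof (cases "S \<inter> Z = {}")
  case False
  then have *: "{G. S \<in> comps n G \<and> Z \<in> comps n G} = {}"
    using comps_disjoint assms(3) by blast
  show ?thesis unfolding * using lo_le_hi hi_le_1 by simp
next
  case True
  note S' = vsetsD[OF S] and Z' = vsetsD[OF Z]
  let ?C = "\<lambda>(T, U). {G. (\<forall>e\<in>T \<union> U. G e) \<and> (\<forall>e\<in>cutset n S \<union> cutset n Z. \<not> G e)}"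
  let ?b = "hi ^ (r - 1 + (r - 1)) * (1 - lo) ^ (2 * (r * (n - r)) - r * r)"
  have "P {G. S \<in> comps n G \<and> Z \<in> comps n G} \<le> P (\<Union>x\<in>Trees S \<times> Trees Z. ?C x)"
  proof (rule prob_mono_support)
    fix G assume G: "G \<in> set_pmf (rgraph n p)" "G \<in> {G. S \<in> comps n G \<and> Z \<in> comps n G}"
    obtain T where T: "T \<in> Trees S" "\<forall>e\<in>T. G e" "\<forall>e\<in>cutset n S. \<not> G e"
      using comps_imp_tree_and_cutset[of S n G] rgraph_support[OF G(1)] G(2) by blast
    obtain U where U: "U \<in> Trees Z" "\<forall>e\<in>U. G e" "\<forall>e\<in>cutset n Z. \<not> G e"
      using comps_imp_tree_and_cutset[of Z n G] rgraph_support[OF G(1)] G(2) by blast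
    have "G \<in> ?C (T, U)" using T U by auto
    then show "G \<in> (\<Union>x\<in>Trees S \<times> Trees Z. ?C x)" using T(1) U(1) by blast
  qed
  also have "\<dots> \<le> (\<Sum>x\<in>Trees S \<times> Trees Z. P (?C x))"
    using S' Z' by (intro measure_pmf.finite_measure_subadditive_finite) auto
  also have "\<dots> \<le> (\<Sum>x\<in>Trees S \<times> Trees Z. ?b)"
  proof (rule sum_mono)
    fix x assume "x \<in> Trees S \<times> Trees Z"
    then obtain T U where x: "x = (T, U)" and T: "T \<in> Trees S" and U: "U \<in> Trees Z" by auto
    have sub: "T \<subseteq> Edges S" "U \<subseteq> Edges Z" using T U by (auto simp: Trees_def)
    \<comment> \<open>The product formula requires disjoint open and closed edges. A cut edge of
      \<open>S\<close> has one endpoint outside \<open>S\<close> and the other outside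
      \<open>Z\<close>, so it lies in neither tree; likewise for \<open>Z\<close>.\<close>
    have disj: "(T \<union> U) \<inter> (cutset n S \<union> cutset n Z) = {}"
      using sub cutset_Edges_disjoint[of n S] cutset_Edges_disjoint[of n Z] True
        cutset_Edges_disjoint'[of S Z n] cutset_Edges_disjoint'[of Z S n] by blast
    have "T \<inter> U = {}" using sub Edges_disjoint[OF True] by blast
    moreover have "finite T" "finite U" using sub S' Z' finite_subset finite_Edges by blast+
    ultimately have c: "card (T \<union> U) = r - 1 + (r - 1)"
      using T U S' Z' by (simp add: card_Un_disjoint Trees_def)
    have "P (?C x) \<le> hi ^ card (T \<union> U) * (1 - lo) ^ card (cutset n S \<union> cutset n Z)"
      unfolding x prod.case
      using Trees_subset_Kedges[OF S T] Trees_subset_Kedges[OF Z U] disj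
        cutset_subset_Kedges[OF S'(1)] cutset_subset_Kedges[OF Z'(1)]
      by (intro prob_cylinder_le) auto
    also have "\<dots> \<le> ?b"
      unfolding c using card_cutset_Un_ge[OF S'(1) Z'(1) True S'(2) Z'(2)] lo_nonneg lo_le_hi hi_le_1
      by (intro mult_left_mono power_decreasing) auto
    finally show "P (?C x) \<le> ?b" .
  qed
  also have "\<dots> = ?B"
    using S' Z' by (simp add: card_Trees card_cartesian_product power2_eq_square power_add)
  finally show ?thesis .
qed

text \<open>Asking that \<open>T\<close> be exactly the open graph inside \<open>S\<close> makes the
  events for different trees disjoint, so their probabilities add up.\<close>

lemma prob_comp_ge:
  assumes S: "S \<in> vsets n r" and "r \<ge> 1"
  shows "labelled_trees r * lo ^ (r - 1) * (1 - hi) ^ (r * n) \<le> P {G. S \<in> comps n G}"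
proof -
  note S' = vsetsD[OF S]
  have ne: "S \<noteq> {}" using assms S' by auto
  let ?N = "\<lambda>T. (Edges S - T) \<union> cutset n S"
  let ?C = "\<lambda>T. {G. (\<forall>e\<in>T. G e) \<and> (\<forall>e\<in>?N T. \<not> G e)}"
  have "labelled_trees r * lo ^ (r - 1) * (1 - hi) ^ (r * n) =
      (\<Sum>T\<in>Trees S. lo ^ (r - 1) * (1 - hi) ^ (r * n))"
    using S' by (simp add: card_Trees)
  also have "\<dots> \<le> (\<Sum>T\<in>Trees S. P (?C T))"
  proof (rule sum_mono)
    fix T assume T: "T \<in> Trees S"
    \<comment> \<open>The exponent \<open>r * n\<close> bounds the number of closed edges: at most
      \<open>r * r\<close> inside \<open>S\<close> and \<open>r * (n - r)\<close> in the
      cut.\<close>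
    have "card (?N T) \<le> card (Edges S - T) + card (cutset n S)" by (rule card_Un_le)
    also have "\<dots> \<le> r * r + r * (n - r)"
      using card_Edges_le[OF S'(3)] card_mono[of "Edges S" "Edges S - T"] S'
      by (intro add_mono) (auto simp: card_cutset)
    also have "\<dots> = r * n" using S'(4) by (simp add: add_mult_distrib2[symmetric])
    finally have "lo ^ (r - 1) * (1 - hi) ^ (r * n) \<le> lo ^ card T * (1 - hi) ^ card (?N T)"
      using T S' lo_nonneg lo_le_hi hi_le_1
      by (auto intro!: mult_left_mono power_decreasing simp: Trees_def)
    also have "\<dots> \<le> P (?C T)"
      using Trees_subset_Kedges[OF S T] cutset_subset_Kedges[OF S'(1)] cutset_Edges_disjoint[of n S] T
        Edges_mono[OF S'(1)]
      by (intro prob_cylinder_ge) (auto simp: Trees_def Kedges_eq_Edges)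
    finally show "lo ^ (r - 1) * (1 - hi) ^ (r * n) \<le> P (?C T)" .
  qed
  also have "\<dots> = P (\<Union>T\<in>Trees S. ?C T)"
  proof (rule measure_pmf.finite_measure_finite_Union[symmetric])
    show "disjoint_family_on ?C (Trees S)"
      unfolding disjoint_family_on_def
    proof (intro ballI impI)
      fix T U assume TU: "T \<in> Trees S" "U \<in> Trees S" "T \<noteq> U"
      have "T = U" if "G \<in> ?C T" "G \<in> ?C U" for G
        using that TU(1,2) unfolding Trees_def by blast
      with TU show "?C T \<inter> ?C U = {}" by blast
    qed
  qed (use S' in auto)
  also have "\<dots> \<le> P {G. S \<in> comps n G}"
  proof (rule prob_mono_support)
    fix G assume G: "G \<in> set_pmf (rgraph n p)" "G \<in> (\<Union>T\<in>Trees S. ?C T)"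
    then obtain T where T: "T \<in> Trees S" "G \<in> ?C T" by blast
    then show "G \<in> {G. S \<in> comps n G}"
      using tree_and_cutset_imp_comps[OF ne S'(1) T(1) rgraph_support[OF G(1)]] by blast
  qed
  finally show ?thesis .
qed

section \<open>First and second moments of the component counts\<close>

lemma expectation_num_comps:
  "E (\<lambda>G. real (num_comps n r G)) = (\<Sum>S\<in>vsets n r. P {G. S \<in> comps n G})"
proof -
  have "E (\<lambda>G. real (num_comps n r G)) = E (\<lambda>G. \<Sum>S\<in>vsets n r. indicator {G. S \<in> comps n G} G)"
    by (rule integral_cong_AE) (auto simp: AE_measure_pmf_iff num_comps_eq_sum)
  then show ?thesis by simp
qed

lemma expectation_num_comps_le:
  "E (\<lambda>G. real (num_comps n r G)) \<le>
    (n choose r) * (labelled_trees r * hi ^ (r - 1) * (1 - lo) ^ (r * (n - r)))"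
proof -
  have "(\<Sum>S\<in>vsets n r. P {G. S \<in> comps n G}) \<le>
      (\<Sum>S\<in>vsets n r. labelled_trees r * hi ^ (r - 1) * (1 - lo) ^ (r * (n - r)))"
    by (rule sum_mono) (rule prob_comp_le)
  then show ?thesis by (simp add: expectation_num_comps card_vsets)
qed

lemma expectation_num_comps_ge:
  assumes "r \<ge> 1"
  shows "(n choose r) * (labelled_trees r * lo ^ (r - 1) * (1 - hi) ^ (r * n)) \<le>
    E (\<lambda>G. real (num_comps n r G))"
proof -
  have "(\<Sum>S\<in>vsets n r. labelled_trees r * lo ^ (r - 1) * (1 - hi) ^ (r * n)) \<le>
      (\<Sum>S\<in>vsets n r. P {G. S \<in> comps n G})"
    by (rule sum_mono) (rule prob_comp_ge[OF _ assms])
  then show ?thesis by (simp add: expectation_num_comps card_vsets)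
qed

text \<open>The square expands into pairs of vertex sets: equal pairs contribute the mean, at most
  \<open>n\<close>, and distinct pairs obey the two-component bound.\<close>

lemma expectation_num_comps_sq_le:
  "E (\<lambda>G. (real (num_comps n r G))\<^sup>2) \<le>
    n + ((n choose r) * (labelled_trees r * hi ^ (r - 1)))\<^sup>2 * (1 - lo) ^ (2 * (r * (n - r)) - r * r)"
proof -
  let ?V = "vsets n r" and ?I = "\<lambda>S. indicator {G. S \<in> comps n G} :: _ \<Rightarrow> real"
  let ?b = "(labelled_trees r * hi ^ (r - 1))\<^sup>2 * (1 - lo) ^ (2 * (r * (n - r)) - r * r)"
  have b: "0 \<le> ?b" using lo_nonneg lo_le_hi hi_le_1 by auto
  have "E (\<lambda>G. (real (num_comps n r G))\<^sup>2) = E (\<lambda>G. \<Sum>S\<in>?V. \<Sum>Z\<in>?V. ?I S G * ?I Z G)"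
    by (rule integral_cong_AE)
      (auto simp: AE_measure_pmf_iff num_comps_eq_sum power2_eq_square sum_product)
  also have "\<dots> = (\<Sum>S\<in>?V. \<Sum>Z\<in>?V. E (\<lambda>G. ?I S G * ?I Z G))"
    by (simp only: Bochner_Integration.integral_sum integrable_rgraph)
  also have "\<dots> = (\<Sum>S\<in>?V. \<Sum>Z\<in>?V. P {G. S \<in> comps n G \<and> Z \<in> comps n G})"
  proof (intro sum.cong refl)
    fix S Z
    have "(\<lambda>G. ?I S G * ?I Z G) = indicator {G. S \<in> comps n G \<and> Z \<in> comps n G}"
      by (auto simp: indicator_def)
    then show "E (\<lambda>G. ?I S G * ?I Z G) = P {G. S \<in> comps n G \<and> Z \<in> comps n G}" by simp
  qed
  \<comment> \<open>The nonnegative \<open>?b\<close> is added on the diagonal too, so that its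
    double sum is a plain product.\<close>
  also have "\<dots> \<le> (\<Sum>S\<in>?V. \<Sum>Z\<in>?V. (if S = Z then P {G. S \<in> comps n G} else 0) + ?b)"
  proof (intro sum_mono)
    fix S Z assume "S \<in> ?V" "Z \<in> ?V"
    then show "P {G. S \<in> comps n G \<and> Z \<in> comps n G} \<le>
        (if S = Z then P {G. S \<in> comps n G} else 0) + ?b"
      using prob_two_comps_le[of S r Z] b by auto
  qed
  also have "\<dots> = E (\<lambda>G. real (num_comps n r G)) + (n choose r) * ((n choose r) * ?b)"
    unfolding expectation_num_comps by (simp add: sum.distrib card_vsets)
  also have "E (\<lambda>G. real (num_comps n r G)) \<le> E (\<lambda>G. real n)"
    by (rule integral_mono) (auto simp: num_comps_le)
  finally show ?thesis by (simp add: power2_eq_square algebra_simps)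
qed

end

section \<open>Asymptotics\<close>

lemma power_div_fact_le_exp:
  fixes x :: real
  assumes "0 \<le> x" shows "x ^ r / fact r \<le> exp x"
proof -
  have s: "(\<lambda>k. x ^ k / fact k) sums exp x"
    using exp_converges[of x] by (simp add: scaleR_conv_of_real divide_inverse mult.commute)
  have "(\<Sum>k\<in>{r}. x ^ k / fact k) \<le> (\<Sum>k. x ^ k / fact k)"
    using assms by (intro sum_le_suminf sums_summable[OF s]) auto
  then show ?thesis using sums_unique[OF s] by simp
qed

text \<open>Since \<open>labelled_trees r\<close> is at most \<open>r ^ (r - 1)\<close>, the left
  side is at most \<open>r ^ r / fact r\<close>, a single term of the series of
  \<open>exp r\<close>.\<close>

lemma labelled_trees_div_fact_le:
  assumes "r \<ge> 1"
  shows "real r * real (labelled_trees r) / fact r \<le> exp (real r)"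
proof -
  have "real r * real (labelled_trees r) \<le> real r * real (r ^ (r - 1))"
    using labelled_trees_le[of r] by (intro mult_left_mono) auto
  also have "\<dots> = real r ^ r" using assms by (cases r) auto
  finally have "real r * real (labelled_trees r) / fact r \<le> real r ^ r / fact r"
    by (rule divide_right_mono) simp
  also have "\<dots> \<le> exp (real r)" by (rule power_div_fact_le_exp) simp
  finally show ?thesis .
qed

text \<open>Induction through \<open>(r + 1) * (n choose (r + 1)) = (n - r) * (n choose r)\<close>:
  each step contributes the factor \<open>(1 - r / n) / (r + 1)\<close>.\<close>

lemma choose_div_power_tendsto:
  "(\<lambda>n. real (n choose r) / real n ^ r) \<longlonglongrightarrow> 1 / fact r"
proof (induction r)
  case (Suc r)
  have "(\<lambda>n. real (n choose r) / real n ^ r * (1 - real r / real n) / real (Suc r)) \<longlonglongrightarrow>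
      1 / fact r * (1 - 0) / real (Suc r)"
    by (intro tendsto_intros Suc lim_const_over_n) auto
  moreover have "\<forall>\<^sub>F n in sequentially.
      real (n choose r) / real n ^ r * (1 - real r / real n) / real (Suc r) =
      real (n choose Suc r) / real n ^ Suc r"
  proof (rule eventually_sequentiallyI[of "Suc r"])
    fix n assume n: "Suc r \<le> n"
    have "Suc r * (n choose Suc r) = (n - r) * (n choose r)"
      using binomial_absorb_comp[of n r] binomial_absorption[of r "n"] n
      by (metis Suc_le_D Suc_times_binomial_eq binomial_absorption mult.commute)
    then have "real (Suc r) * real (n choose Suc r) = (real n - real r) * real (n choose r)"
      using n by (metis Suc_leD of_nat_diff of_nat_mult)
    then have "real (n choose Suc r) = (real n - real r) * real (n choose r) / real (Suc r)"
      by (simp add: field_simps del: of_nat_Suc)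
    moreover have "1 - real r / real n = (real n - real r) / real n"
      using n by (simp add: diff_divide_distrib)
    ultimately show "real (n choose r) / real n ^ r * (1 - real r / real n) / real (Suc r) =
        real (n choose Suc r) / real n ^ Suc r"
      by (simp add: mult_ac del: of_nat_Suc)
  qed
  ultimately have "(\<lambda>n. real (n choose Suc r) / real n ^ Suc r) \<longlonglongrightarrow> 1 / fact r * (1 - 0) / real (Suc r)"
    by (rule Lim_transform_eventually)
  then show ?case by (simp only: diff_zero mult_1 mult_1_right divide_divide_eq_left fact_Suc mult.commute)
qed simp

text \<open>Counterpart of \<open>1 - x \<le> exp (- x)\<close>, for lower bounds on the probability
  that edges are closed.\<close>

lemma one_minus_ge_exp:
  fixes x :: real
  assumes "x < 1" shows "exp (- (x / (1 - x))) \<le> 1 - x"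
proof -
  have "1 / (1 - x) = 1 + x / (1 - x)" using assms by (simp add: field_simps)
  also have "\<dots> \<le> exp (x / (1 - x))" by (rule exp_ge_add_one_self)
  finally show ?thesis using assms by (simp add: exp_minus field_simps)
qed

lemma geometric_tail_le:
  fixes x :: real
  assumes "0 < x" "x < 1" shows "(\<Sum>r\<in>{a..m}. x ^ r) \<le> x ^ a / (1 - x)"
proof (cases "a \<le> m")
  case True
  then show ?thesis using assms by (simp add: sum_gp divide_right_mono)
qed (use assms in simp)

section \<open>The limiting density of components of each size\<close>

definition comp_density :: "real \<Rightarrow> nat \<Rightarrow> real" where
  "comp_density C r = real (labelled_trees r) * C ^ (r - 1) * exp (- (real r * C)) / fact r"

lemma comp_density_nonneg: "0 < C \<Longrightarrow> 0 \<le> comp_density C r"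
  by (simp add: comp_density_def)

text \<open>In the exponent, the tree count contributes \<open>r\<close>, the open edges
  \<open>r * ln C\<close> and the closed edges \<open>- r * C\<close>.\<close>

lemma comp_density_le:
  assumes "0 < C" "r \<ge> 1"
  shows "real r * comp_density C r \<le> exp (- (C - 1 - ln C)) ^ r / C"
proof -
  have "real r * comp_density C r =
      (real r * real (labelled_trees r) / fact r) * (C ^ (r - 1) * exp (- (real r * C)))"
    by (simp add: comp_density_def)
  also have "\<dots> \<le> exp (real r) * (C ^ (r - 1) * exp (- (real r * C)))"
    using assms labelled_trees_div_fact_le by (intro mult_right_mono) auto
  also have "C ^ (r - 1) = C ^ r / C"
    using assms by (cases r) simp_all
  also have "C ^ r = exp (real r * ln C)"
    using assms by (simp add: exp_of_nat_mult)
  also have "exp (real r) * (exp (real r * ln C) / C * exp (- (real r * C))) =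
      exp (- (C - 1 - ln C)) ^ r / C"
    by (simp add: exp_of_nat_mult[symmetric] exp_add[symmetric] algebra_simps)
  finally show ?thesis .
qed

text \<open>With \<open>r = k + 1\<close>, the term \<open>r * comp_density C r\<close> is the term
  of \<open>qC C\<close> at index \<open>k\<close>, because
  \<open>(k + 1) / fact (k + 1) = 1 / fact k\<close>. The geometric bound gives convergence.\<close>

lemma qC_sums:
  assumes "0 < C" "C - 1 - ln C > 0"
  shows "(\<lambda>k. real (Suc k) * comp_density C (Suc k)) sums qC C"
proof -
  have eq: "real (Suc k) * comp_density C (Suc k) =
      real (labelled_trees (k + 1)) * C ^ k * exp (- C * real (k + 1)) / fact k" for k
  proof -
    have "- (real (Suc k) * C) = - C * real (k + 1)" by simp
    then show ?thesis unfolding comp_density_def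
      by (simp add: divide_simps del: of_nat_Suc)
  qed
  have "summable (\<lambda>k. exp (- (C - 1 - ln C)) ^ Suc k / C)"
    using assms by (intro summable_divide) (simp only: summable_Suc_iff, rule summable_geometric, simp)
  then have "summable (\<lambda>k. real (Suc k) * comp_density C (Suc k))"
  proof (rule summable_comparison_test'[where N = 0])
    fix k
    show "norm (real (Suc k) * comp_density C (Suc k)) \<le> exp (- (C - 1 - ln C)) ^ Suc k / C"
      using comp_density_le[OF assms(1), of "Suc k"] comp_density_nonneg[OF assms(1), of "Suc k"]
      by (simp add: abs_mult)
  qed
  then show ?thesis unfolding qC_def eq by (rule summable_sums)
qed

text \<open>Later \<open>c\<close> and \<open>d\<close> are \<open>C - as n\<close> and
  \<open>C + as n\<close>. The factor \<open>r\<close> joins the tree count, so that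
  \<open>r * labelled_trees r / fact r\<close> is at most \<open>exp r\<close>.\<close>

lemma (in edge_bounds) size_times_expectation_le:
  assumes "1 \<le> r" "r \<le> n" "lo = c / real n" "hi = d / real n" "0 < d"
  shows "real r * E (\<lambda>G. real (num_comps n r G)) \<le>
    real n / d * exp (- (c * (1 - real r / real n) - 1 - ln d)) ^ r"
proof -
  have n: "n > 0" using assms by simp
  have "real r * E (\<lambda>G. real (num_comps n r G)) \<le>
      real r * ((n choose r) * (labelled_trees r * hi ^ (r - 1) * (1 - lo) ^ (r * (n - r))))"
    by (intro mult_left_mono expectation_num_comps_le) simp
  also have "\<dots> = (n choose r) * (real r * labelled_trees r) * (hi ^ (r - 1) * (1 - lo) ^ (r * (n - r)))"
    by simp
  also have "\<dots> \<le> (real n ^ r / fact r) * (real r * labelled_trees r) *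
      (hi ^ (r - 1) * exp (- lo * real (r * (n - r))))"
  proof (intro mult_mono)
    show "real (n choose r) \<le> real n ^ r / fact r"
    proof -
      have "real ((n choose r) * fact r) \<le> real (n ^ r)"
        by (simp only: of_nat_le_iff binomial_fact_pow)
      then show ?thesis by (simp add: pos_le_divide_eq)
    qed
    have "(1 - lo) ^ (r * (n - r)) \<le> exp (- lo) ^ (r * (n - r))"
      using lo_le_hi hi_le_1 exp_ge_add_one_self[of "- lo"] by (intro power_mono) auto
    then show "(1 - lo) ^ (r * (n - r)) \<le> exp (- lo * real (r * (n - r)))"
      by (simp add: exp_of_nat_mult[symmetric] mult.commute)
  qed (use lo_nonneg lo_le_hi hi_le_1 in auto)
  also have "\<dots> = (real r * labelled_trees r / fact r) *
      (real n ^ r * hi ^ (r - 1) * exp (- lo * real (r * (n - r))))"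
    by simp
  also have "\<dots> \<le> exp (real r) * (real n ^ r * hi ^ (r - 1) * exp (- lo * real (r * (n - r))))"
    using assms labelled_trees_div_fact_le lo_nonneg lo_le_hi by (intro mult_right_mono) auto
  \<comment> \<open>A tree has \<open>r - 1\<close> edges on \<open>r\<close> vertices, so one
    factor \<open>n\<close> survives.\<close>
  also have "real n ^ r * hi ^ (r - 1) = real n / d * d ^ r"
    using assms n by (cases r) (simp_all add: power_divide)
  also have "d ^ r = exp (real r * ln d)" using assms by (simp add: exp_of_nat_mult)
  also have "- lo * real (r * (n - r)) = - (real r * (c * (1 - real r / real n)))"
  proof -
    have "c * (1 - real r / real n) = lo * (real n * (1 - real r / real n))"
      using assms n by simp
    also have "real n * (1 - real r / real n) = real n - real r"
      using n by (simp add: right_diff_distrib)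
    finally show ?thesis using assms by (simp add: of_nat_diff)
  qed
  also have "exp (real r) * (real n / d * exp (real r * ln d) *
      exp (- (real r * (c * (1 - real r / real n))))) =
      real n / d * exp (real r + real r * ln d - real r * (c * (1 - real r / real n)))"
    by (simp add: exp_add exp_diff exp_minus divide_inverse)
  also have "real r + real r * ln d - real r * (c * (1 - real r / real n)) =
      real r * (- (c * (1 - real r / real n) - 1 - ln d))"
    by (simp add: algebra_simps)
  finally show ?thesis by (simp only: exp_of_nat_mult)
qed

section \<open>The sequence of random graphs and concentration of its component counts\<close>

locale sparse_graph =
  fixes C :: real and as :: "nat \<Rightarrow> real" and p :: "nat \<Rightarrow> nat set \<Rightarrow> real"
  assumes C_pos: "0 < C" and as_nonneg: "\<And>n. 0 \<le> as n" and as_lim: "as \<longlonglongrightarrow> 0"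
    and p_bounds: "\<And>n e. 1 \<le> n \<Longrightarrow> e \<in> Kedges n \<Longrightarrow>
      (C - as n) / real n \<le> p n e \<and> p n e \<le> (C + as n) / real n"
begin

abbreviation "prb n \<equiv> measure_pmf.prob (rgraph n (p n))"
abbreviation "expn n \<equiv> measure_pmf.expectation (rgraph n (p n))"
abbreviation "lo n \<equiv> (C - as n) / real n"
abbreviation "hi n \<equiv> (C + as n) / real n"

lemma c_minus_lim: "(\<lambda>n. C - as n) \<longlonglongrightarrow> C"
  using tendsto_diff[OF tendsto_const as_lim, of C] by simp

lemma c_plus_lim: "(\<lambda>n. C + as n) \<longlonglongrightarrow> C"
  using tendsto_add[OF tendsto_const as_lim, of C] by simp

lemma hi_lim: "hi \<longlonglongrightarrow> 0"
  using tendsto_mult[OF c_plus_lim lim_const_over_n[of 1]] by simp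

text \<open>The bounds lie between 0 and 1 once \<open>as n < C\<close> and \<open>hi n < 1\<close>,
  hence for all large \<open>n\<close>.\<close>

lemma eventually_edge_bounds:
  "\<forall>\<^sub>F n in sequentially. 1 \<le> n \<and> hi n < 1 \<and> edge_bounds n (p n) (lo n) (hi n)"
proof -
  have "\<forall>\<^sub>F n in sequentially. 1 \<le> n" by (rule eventually_ge_at_top)
  moreover have "\<forall>\<^sub>F n in sequentially. 0 < C - as n"
    using order_tendstoD(1)[OF c_minus_lim C_pos] .
  moreover have "\<forall>\<^sub>F n in sequentially. hi n < 1"
    using order_tendstoD(2)[OF hi_lim] by simp
  ultimately show ?thesis
  proof eventually_elim
    case (elim n)
    then show ?case
      using p_bounds[of n] as_nonneg[of n] by (auto simp: edge_bounds_def divide_right_mono)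
  qed
qed

text \<open>Chebyshev's argument centred at the limit \<open>comp_density C r\<close> instead of the
  mean: it takes a lower bound on the first moment and an upper bound on the second.\<close>

lemma num_comps_concentrated:
  assumes "1 \<le> r" "0 < \<epsilon>"
  shows "(\<lambda>n. prb n {G. \<epsilon> \<le> \<bar>real (num_comps n r G) / real n - comp_density C r\<bar>}) \<longlonglongrightarrow> 0"
proof -
  let ?v = "comp_density C r" and ?Y = "\<lambda>n G. real (num_comps n r G)"
  let ?t = "real (labelled_trees r)" and ?b = "\<lambda>n. real (n choose r) / real n ^ r"
  \<comment> \<open>For large \<open>n\<close>, \<open>A n\<close> bounds the mean of the count
    divided by \<open>n\<close> from below, and \<open>B n\<close> bounds the mean of the square of
    that ratio from above.\<close>
  define A where "A n = ?b n * ?t * (C - as n) ^ (r - 1) * exp (- (hi n / (1 - hi n)) * real (r * n))" for n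
  define B where "B n = 1 / real n + (?b n * ?t * (C + as n) ^ (r - 1))\<^sup>2 *
    exp (- lo n * (2 * (real r * (real n - real r)) - real r * real r))" for n
  have inv: "(\<lambda>n. 1 / real n) \<longlonglongrightarrow> 0" by (rule lim_const_over_n)
  have "A \<longlonglongrightarrow> 1 / fact r * ?t * C ^ (r - 1) * exp (- (real r * (C / (1 - 0))))"
  proof -
    have "(\<lambda>n. ?b n * ?t * (C - as n) ^ (r - 1) * exp (- (real r * ((C + as n) / (1 - hi n)))))
        \<longlonglongrightarrow> 1 / fact r * ?t * C ^ (r - 1) * exp (- (real r * (C / (1 - 0))))"
      by (intro tendsto_intros choose_div_power_tendsto c_minus_lim c_plus_lim hi_lim) simp
    moreover have "\<forall>\<^sub>F n in sequentially. ?b n * ?t * (C - as n) ^ (r - 1) *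
        exp (- (real r * ((C + as n) / (1 - hi n)))) = A n"
      using eventually_gt_at_top[of 0]
    proof eventually_elim
      case (elim n)
      have "h / (1 - h) * real (r * n) = real r * ((h * real n) / (1 - h))" for h by simp
      moreover have "hi n * real n = C + as n" using elim by simp
      ultimately have "real r * ((C + as n) / (1 - hi n)) = hi n / (1 - hi n) * real (r * n)" by metis
      then show ?case by (simp only: A_def minus_mult_left)
    qed
    ultimately show ?thesis by (rule Lim_transform_eventually)
  qed
  then have A: "A \<longlonglongrightarrow> ?v" by (simp add: comp_density_def)
  have "B \<longlonglongrightarrow> 0 + (1 / fact r * ?t * C ^ (r - 1))\<^sup>2 * exp (- (C * (2 * (real r * (1 - real r * 0)) - real r * real r * 0)))"
  proof -
    have "(\<lambda>n. 1 / real n + (?b n * ?t * (C + as n) ^ (r - 1))\<^sup>2 *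
        exp (- ((C - as n) * (2 * (real r * (1 - real r * (1 / real n))) - real r * real r * (1 / real n)))))
        \<longlonglongrightarrow> 0 + (1 / fact r * ?t * C ^ (r - 1))\<^sup>2 *
          exp (- (C * (2 * (real r * (1 - real r * 0)) - real r * real r * 0)))"
      by (intro tendsto_intros choose_div_power_tendsto c_minus_lim c_plus_lim inv)
    moreover have "\<forall>\<^sub>F n in sequentially. 1 / real n + (?b n * ?t * (C + as n) ^ (r - 1))\<^sup>2 *
        exp (- ((C - as n) * (2 * (real r * (1 - real r * (1 / real n))) - real r * real r * (1 / real n)))) = B n"
      using eventually_gt_at_top[of 0]
    proof eventually_elim
      case (elim n)
      then have "(C - as n) * (2 * (real r * (1 - real r * (1 / real n))) - real r * real r * (1 / real n)) =
          lo n * (2 * (real r * (real n - real r)) - real r * real r)"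
        by (simp add: field_simps)
      then show ?case by (simp only: B_def minus_mult_left)
    qed
    ultimately show ?thesis by (rule Lim_transform_eventually)
  qed
  \<comment> \<open>The exponent \<open>2 * r * C\<close> makes this limit exactly the square of
    \<open>?v\<close>, so the Chebyshev bound tends to 0.\<close>
  also have "0 + (1 / fact r * ?t * C ^ (r - 1))\<^sup>2 *
      exp (- (C * (2 * (real r * (1 - real r * 0)) - real r * real r * 0))) = ?v\<^sup>2"
    by (simp add: comp_density_def power_mult_distrib power_divide exp_double[symmetric] mult_ac)
  finally have B: "B \<longlonglongrightarrow> ?v\<^sup>2" .
  have "(\<lambda>n. (B n - 2 * ?v * A n + ?v\<^sup>2) / \<epsilon>\<^sup>2) \<longlonglongrightarrow> (?v\<^sup>2 - 2 * ?v * ?v + ?v\<^sup>2) / \<epsilon>\<^sup>2"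
    using assms by (intro tendsto_intros A B) auto
  then have lim: "(\<lambda>n. (B n - 2 * ?v * A n + ?v\<^sup>2) / \<epsilon>\<^sup>2) \<longlonglongrightarrow> 0"
    by (simp add: power2_eq_square)
  have "\<forall>\<^sub>F n in sequentially. prb n {G. \<epsilon> \<le> \<bar>?Y n G / real n - ?v\<bar>} \<le>
      (B n - 2 * ?v * A n + ?v\<^sup>2) / \<epsilon>\<^sup>2"
    using eventually_edge_bounds eventually_ge_at_top[of r]
  proof eventually_elim
    case (elim n)
    then have n: "1 \<le> n" "r \<le> n" "hi n < 1" and eb: "edge_bounds n (p n) (lo n) (hi n)" by auto
    interpret edge_bounds n "p n" "lo n" "hi n" by (rule eb)
    have "A n \<le> (n choose r) * (?t * lo n ^ (r - 1) * (1 - hi n) ^ (r * n)) / real n"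
    proof -
      have "exp (- (hi n / (1 - hi n)) * real (r * n)) = exp (- (hi n / (1 - hi n))) ^ (r * n)"
        by (simp add: exp_of_nat_mult[symmetric] mult.commute)
      also have "\<dots> \<le> (1 - hi n) ^ (r * n)"
        using one_minus_ge_exp[OF n(3)] by (intro power_mono) auto
      finally have "A n \<le> ?b n * ?t * (C - as n) ^ (r - 1) * (1 - hi n) ^ (r * n)"
        unfolding A_def using lo_nonneg n by (intro mult_left_mono) (auto simp: zero_le_divide_iff)
      also have "\<dots> = (n choose r) * (?t * lo n ^ (r - 1) * (1 - hi n) ^ (r * n)) / real n"
        using n assms by (cases r) (auto simp: power_divide mult_ac)
      finally show ?thesis .
    qed
    also have "\<dots> \<le> E (?Y n) / real n"
      by (intro divide_right_mono expectation_num_comps_ge assms) simp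
    finally have EY: "A n \<le> E (?Y n) / real n" .
    have "E (\<lambda>G. (?Y n G)\<^sup>2) / (real n)\<^sup>2 \<le> (n + ((n choose r) * (?t * hi n ^ (r - 1)))\<^sup>2 *
        (1 - lo n) ^ (2 * (r * (n - r)) - r * r)) / (real n)\<^sup>2"
      by (intro divide_right_mono expectation_num_comps_sq_le) simp
    also have "\<dots> = 1 / real n + (?b n * ?t * (C + as n) ^ (r - 1))\<^sup>2 *
        (1 - lo n) ^ (2 * (r * (n - r)) - r * r)"
    proof -
      have "(n choose r) * (?t * hi n ^ (r - 1)) = real n * (?b n * ?t * (C + as n) ^ (r - 1))"
        using n assms by (cases r) (auto simp: power_divide mult_ac)
      then show ?thesis using n by (simp add: power_mult_distrib add_divide_distrib power2_eq_square)
    qed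
    also have "\<dots> \<le> B n"
    proof -
      have "(1 - lo n) ^ (2 * (r * (n - r)) - r * r) \<le> exp (- lo n) ^ (2 * (r * (n - r)) - r * r)"
        using lo_le_hi hi_le_1 exp_ge_add_one_self[of "- lo n"] by (intro power_mono) auto
      also have "\<dots> = exp (- lo n * real (2 * (r * (n - r)) - r * r))"
        by (simp add: exp_of_nat_mult[symmetric] mult.commute)
      also have "\<dots> \<le> exp (- lo n * (2 * (real r * (real n - real r)) - real r * real r))"
      proof -
        \<comment> \<open>Truncated subtraction yields at least the real difference, and as
          \<open>lo n\<close> is nonnegative a larger count only decreases the exponential.\<close>
        have "2 * (real r * (real n - real r)) - real r * real r = real (2 * (r * (n - r))) - real (r * r)"
          using n by (simp add: of_nat_diff)
        also have "\<dots> \<le> real (2 * (r * (n - r)) - r * r)" by linarith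
        finally show ?thesis using mult_left_mono[OF _ lo_nonneg] by fastforce
      qed
      finally show ?thesis unfolding B_def by (intro add_mono mult_left_mono) auto
    qed
    finally have EY2: "E (\<lambda>G. (?Y n G)\<^sup>2) / (real n)\<^sup>2 \<le> B n" .
    have "prb n {G. \<epsilon> \<le> \<bar>?Y n G / real n - ?v\<bar>} = prb n {G. \<epsilon>\<^sup>2 \<le> (?Y n G / real n - ?v)\<^sup>2}"
      using assms by (simp add: abs_le_square_iff[symmetric])
    also have "\<dots> \<le> E (\<lambda>G. (?Y n G / real n - ?v)\<^sup>2) / \<epsilon>\<^sup>2"
      using integral_Markov_inequality_measure[of "rgraph n (p n)" "\<lambda>G. (?Y n G / real n - ?v)\<^sup>2" UNIV "\<epsilon>\<^sup>2"] assms
      by simp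
    also have "E (\<lambda>G. (?Y n G / real n - ?v)\<^sup>2) =
        E (\<lambda>G. (?Y n G)\<^sup>2 / (real n)\<^sup>2 - 2 * ?v / real n * ?Y n G + ?v\<^sup>2)"
      by (simp add: power2_diff power_divide mult_ac)
    also have "\<dots> = E (\<lambda>G. (?Y n G)\<^sup>2) / (real n)\<^sup>2 - 2 * ?v * (E (?Y n) / real n) + ?v\<^sup>2"
      by simp
    also have "\<dots> \<le> B n - 2 * ?v * A n + ?v\<^sup>2"
      using EY2 mult_left_mono[OF EY, of "2 * ?v"] comp_density_nonneg[OF C_pos, of r] by simp
    finally show ?case using assms by (simp add: divide_right_mono)
  qed
  then show ?thesis
    by (rule tendsto_sandwich[OF _ _ tendsto_const lim, rotated]) simp
qed

end

section \<open>First-moment bounds for sizes up to \<open>n / 2\<close>\<close>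

context sparse_graph
begin

text \<open>\<open>t\<close> bounds \<open>1 - r / n\<close> from below, and the strict inequality
  absorbs \<open>as n\<close>, uniformly in \<open>r\<close>. The choice \<open>t = 1 / 2\<close>
  covers sizes up to \<open>n / 2\<close>; \<open>t\<close> near 1 gives the better rate for sizes
  small compared to \<open>n\<close>.\<close>

lemma size_times_expectation_decay:
  assumes "0 < t" "\<kappa> < C * t - 1 - ln C"
  shows "\<forall>\<^sub>F n in sequentially. \<forall>r. 1 \<le> r \<and> real r \<le> (1 - t) * real n \<longrightarrow>
    real r * expn n (\<lambda>G. real (num_comps n r G)) \<le> real n / C * exp (- \<kappa>) ^ r"
proof -
  have "(\<lambda>n. (C - as n) * t - 1 - ln (C + as n)) \<longlonglongrightarrow> C * t - 1 - ln C"
    using C_pos by (intro tendsto_intros c_minus_lim c_plus_lim) auto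
  then have "\<forall>\<^sub>F n in sequentially. \<kappa> < (C - as n) * t - 1 - ln (C + as n)"
    using assms(2) by (rule order_tendstoD)
  with eventually_edge_bounds show ?thesis
  proof eventually_elim
    case (elim n)
    then interpret edge_bounds n "p n" "lo n" "hi n" by auto
    have n: "0 < n" using elim by simp
    have c: "0 \<le> C - as n" using lo_nonneg n by (simp add: zero_le_divide_iff)
    have d: "C \<le> C + as n" using as_nonneg[of n] by simp
    show ?case
    proof (intro allI impI)
      fix r assume r: "1 \<le> r \<and> real r \<le> (1 - t) * real n"
      then have t: "t \<le> 1 - real r / real n" using n by (simp add: field_simps)
      then have "real r / real n \<le> 1" using assms(1) by linarith
      then have rn: "r \<le> n" using n by simp
      have "\<kappa> \<le> (C - as n) * (1 - real r / real n) - 1 - ln (C + as n)"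
        using mult_left_mono[OF t c] elim by linarith
      then have "exp (- ((C - as n) * (1 - real r / real n) - 1 - ln (C + as n))) ^ r \<le> exp (- \<kappa>) ^ r"
        by (intro power_mono) auto
      moreover have "real n / (C + as n) \<le> real n / C"
        using d C_pos by (intro divide_left_mono) auto
      ultimately have "real n / (C + as n) *
          exp (- ((C - as n) * (1 - real r / real n) - 1 - ln (C + as n))) ^ r \<le>
          real n / C * exp (- \<kappa>) ^ r"
        using C_pos by (intro mult_mono) auto
      then show "real r * expn n (\<lambda>G. real (num_comps n r G)) \<le> real n / C * exp (- \<kappa>) ^ r"
        using size_times_expectation_le[of r "C - as n" "C + as n"] r rn C_pos d by linarith
    qed
  qed
qed

text \<open>Markov's inequality for the number of vertices in such components: its mean is at most
  \<open>n\<close> times a geometric tail, small once \<open>R\<close> is large, and the factor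
  \<open>n\<close> cancels.\<close>

lemma few_vertices_in_large_small_comps:
  assumes \<eta>: "0 < C / 2 - 1 - ln C" and "0 < x" "0 < \<zeta>"
  shows "\<forall>\<^sub>F R in sequentially. \<forall>\<^sub>F n in sequentially.
    prb n {G. x * real n \<le> (\<Sum>r\<in>{Suc R..n div 2}. real r * real (num_comps n r G))} \<le> \<zeta>"
proof -
  \<comment> \<open>Half the available rate, so that the decay bound applies with strict
    inequality.\<close>
  define \<kappa> where "\<kappa> = (C / 2 - 1 - ln C) / 2"
  define q where "q = exp (- \<kappa>)"
  have \<kappa>: "0 < \<kappa>" "\<kappa> < C * (1/2) - 1 - ln C" using \<eta> by (simp_all add: \<kappa>_def)
  then have q: "0 < q" "q < 1" by (simp_all add: q_def)
  have half: "0 < (1 / 2 :: real)" by simp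
  have "(\<lambda>R. q ^ Suc R / (1 - q) / C / x) \<longlonglongrightarrow> 0 / (1 - q) / C / x"
    using q C_pos assms by (intro tendsto_intros LIMSEQ_Suc LIMSEQ_realpow_zero) auto
  then have "\<forall>\<^sub>F R in sequentially. q ^ Suc R / (1 - q) / C / x < \<zeta>"
    using assms by (intro order_tendstoD(2)) auto
  then show ?thesis
  proof eventually_elim
    case (elim R)
    show ?case
      using size_times_expectation_decay[OF half \<kappa>(2)] eventually_ge_at_top[of 1]
    proof eventually_elim
      case (elim n)
      let ?Z = "\<lambda>G. \<Sum>r\<in>{Suc R..n div 2}. real r * real (num_comps n r G)"
      have "prb n {G. x * real n \<le> ?Z G} \<le> expn n ?Z / (x * real n)"
        using integral_Markov_inequality_measure[of "rgraph n (p n)" ?Z UNIV "x * real n"] assms elim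
        by (simp add: sum_nonneg)
      also have "expn n ?Z = (\<Sum>r\<in>{Suc R..n div 2}. real r * expn n (\<lambda>G. real (num_comps n r G)))"
        by (simp only: Bochner_Integration.integral_sum integrable_rgraph integral_mult_right_zero)
      also have "\<dots> \<le> (\<Sum>r\<in>{Suc R..n div 2}. real n / C * q ^ r)"
      proof (rule sum_mono)
        fix r assume "r \<in> {Suc R..n div 2}"
        then have "1 \<le> r" "real r \<le> (1 - 1/2) * real n" by auto
        then show "real r * expn n (\<lambda>G. real (num_comps n r G)) \<le> real n / C * q ^ r"
          using elim unfolding q_def by blast
      qed
      also have "\<dots> = real n / C * (\<Sum>r\<in>{Suc R..n div 2}. q ^ r)" by (simp add: sum_distrib_left)
      also have "\<dots> \<le> real n / C * (q ^ Suc R / (1 - q))"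
        using C_pos by (intro mult_left_mono geometric_tail_le[OF q]) auto
      finally have "prb n {G. x * real n \<le> ?Z G} \<le> real n / C * (q ^ Suc R / (1 - q)) / (x * real n)"
        using assms by (simp add: divide_right_mono)
      also have "\<dots> = q ^ Suc R / (1 - q) / C / x" using elim by simp
      also have "\<dots> \<le> \<zeta>" using \<open>q ^ Suc R / (1 - q) / C / x < \<zeta>\<close> by simp
      finally show ?case .
    qed
  qed
qed

text \<open>Union bound over two ranges of sizes. Up to \<open>\<epsilon> * n\<close> the rate is
  close enough to \<open>\<delta>\<close> to beat the factor \<open>n\<close>, because
  \<open>M > 1 / \<delta>\<close>; beyond, the weaker rate \<open>\<kappa>\<close> acts on sizes of
  order \<open>n\<close>.\<close>

lemma no_medium_comps:
  assumes \<eta>: "0 < C / 2 - 1 - ln C" and \<delta>: "0 < C - 1 - ln C" and M: "1 / (C - 1 - ln C) < M"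
  shows "(\<lambda>n. prb n {G. \<exists>r. M * ln (real n) < real r \<and> r \<le> n div 2 \<and> num_comps n r G \<noteq> 0}) \<longlonglongrightarrow> 0"
proof -
  define \<delta> where "\<delta> = C - 1 - ln C"
  have \<delta>0: "0 < \<delta>" "1 / \<delta> < M" using \<delta> M by (simp_all add: \<delta>_def)
  have M0: "0 < M" using \<delta>0 by (meson divide_pos_pos less_trans zero_less_one)
  then have M1: "1 / M < \<delta>" using \<delta>0 by (simp add: field_simps)
  \<comment> \<open>The midpoint of \<open>1 / M\<close> and \<open>\<delta>\<close>: a rate below
    \<open>\<delta>\<close> that still satisfies \<open>\<delta>' * M > 1\<close>.\<close>
  define \<delta>' where "\<delta>' = (1 / M + \<delta>) / 2"
  have \<delta>': "0 < \<delta>'" "\<delta>' < \<delta>" "1 / M < \<delta>'" using M1 M0 \<delta>0 add_pos_pos[of "1 / M" \<delta>] by (auto simp: \<delta>'_def)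
  define \<kappa> where "\<kappa> = (C / 2 - 1 - ln C) / 2"
  have \<kappa>: "0 < \<kappa>" "\<kappa> < C * (1/2) - 1 - ln C" using \<eta> by (simp_all add: \<kappa>_def)
  \<comment> \<open>Passing from \<open>C\<close> to \<open>C * (1 - \<epsilon>)\<close> costs
    \<open>\<epsilon> * C\<close>, at most half of \<open>\<delta> - \<delta>'\<close>; the cap
    \<open>1/2\<close> keeps \<open>1 - \<epsilon>\<close> positive.\<close>
  define \<epsilon> where "\<epsilon> = min (1/2) ((\<delta> - \<delta>') / (2 * C))"
  have \<epsilon>: "0 < \<epsilon>" "\<epsilon> \<le> 1/2" "\<epsilon> * C < \<delta> - \<delta>'"
  proof -
    have "\<epsilon> * C \<le> (\<delta> - \<delta>') / (2 * C) * C"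
      using C_pos by (intro mult_right_mono) (auto simp: \<epsilon>_def)
    then show "\<epsilon> * C < \<delta> - \<delta>'" using C_pos \<delta>' by simp
  qed (use \<delta>' C_pos in \<open>auto simp: \<epsilon>_def\<close>)
  have \<epsilon>': "\<delta>' < C * (1 - \<epsilon>) - 1 - ln C" using \<epsilon>(3) by (simp add: \<delta>_def algebra_simps)
  have half: "0 < (1 / 2 :: real)" and pos: "0 < 1 - \<epsilon>" using \<epsilon> by simp_all
  define q where "q = exp (- \<delta>')"
  have q: "0 < q" "q < 1" using \<delta>' by (simp_all add: q_def)
  define b where "b = \<delta>' * M"
  define c where "c = \<kappa> * \<epsilon>"
  have b: "1 < b" using \<delta>'(3) M0 by (simp add: b_def field_simps)
  have c: "0 < c" using \<kappa> \<epsilon> by (simp add: c_def)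
  \<comment> \<open>The first summand comes from the geometric sum starting near
    \<open>M * ln n\<close> and equals a constant times \<open>n\<close> to the power
    \<open>- b\<close>, with \<open>b > 1\<close>; the second adds the bound for sizes above
    \<open>\<epsilon> * n\<close> over at most \<open>n\<close> sizes.\<close>
  let ?B = "\<lambda>n. real n / C * (exp (- (b * ln (real n))) / (1 - q) + real n * exp (- (c * real n)))"
  have "(\<lambda>n::nat. real n * exp (- (b * ln (real n)))) \<longlonglongrightarrow> 0" using b by real_asymp
  moreover have "(\<lambda>n::nat. real n * (real n * exp (- (c * real n)))) \<longlonglongrightarrow> 0" using c by real_asymp
  ultimately have "(\<lambda>n. real n * exp (- (b * ln (real n))) / (1 - q) / C +
      real n * (real n * exp (- (c * real n))) / C) \<longlonglongrightarrow> 0 / (1 - q) / C + 0 / C"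
    using q C_pos by (intro tendsto_intros) auto
  then have lim: "?B \<longlonglongrightarrow> 0" by (simp add: add_divide_distrib distrib_left mult_ac)
  have "\<forall>\<^sub>F n in sequentially. prb n {G. \<exists>r. M * ln (real n) < real r \<and> r \<le> n div 2 \<and>
      num_comps n r G \<noteq> 0} \<le> ?B n"
    using size_times_expectation_decay[OF half \<kappa>(2)] size_times_expectation_decay[OF pos \<epsilon>']
      eventually_ge_at_top[of 2]
  proof eventually_elim
    case (elim n)
    define a where "a = nat \<lceil>M * ln (real n)\<rceil>"
    have ln: "0 < M * ln (real n)" using elim M0 by simp
    then have a: "1 \<le> a" "M * ln (real n) \<le> real a" unfolding a_def by linarith+
    let ?Y = "\<lambda>r G. real (num_comps n r G)"
    have "prb n {G. \<exists>r. M * ln (real n) < real r \<and> r \<le> n div 2 \<and> num_comps n r G \<noteq> 0} \<le>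
        prb n (\<Union>r\<in>{a..n div 2}. {G. 1 \<le> ?Y r G})"
    proof (rule prob_mono_support)
      fix G assume "G \<in> {G. \<exists>r. M * ln (real n) < real r \<and> r \<le> n div 2 \<and> num_comps n r G \<noteq> 0}"
      then obtain r where r: "M * ln (real n) < real r" "r \<le> n div 2" "num_comps n r G \<noteq> 0" by auto
      then have "a \<le> r" unfolding a_def by linarith
      with r show "G \<in> (\<Union>r\<in>{a..n div 2}. {G. 1 \<le> ?Y r G})" by force
    qed
    also have "\<dots> \<le> (\<Sum>r\<in>{a..n div 2}. prb n {G. 1 \<le> ?Y r G})"
      by (intro measure_pmf.finite_measure_subadditive_finite) auto
    also have "\<dots> \<le> (\<Sum>r\<in>{a..n div 2}. real n / C * (q ^ r + exp (- (c * real n))))"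
    proof (rule sum_mono)
      fix r assume r: "r \<in> {a..n div 2}"
      then have r1: "1 \<le> r" "real r \<le> (1 - 1/2) * real n" using a by auto
      have "prb n {G. 1 \<le> ?Y r G} \<le> expn n (?Y r)"
        using integral_Markov_inequality_measure[of "rgraph n (p n)" "?Y r" UNIV 1] by simp
      also have "\<dots> \<le> real r * expn n (?Y r)"
        using r1 mult_right_mono[of 1 "real r" "expn n (?Y r)"] by simp
      also have "\<dots> \<le> real n / C * (q ^ r + exp (- (c * real n)))"
      proof (cases "real r \<le> \<epsilon> * real n")
        case True
        then have "real r * expn n (?Y r) \<le> real n / C * q ^ r"
          using elim(2) r1 by (simp add: q_def)
        also have "\<dots> \<le> real n / C * (q ^ r + exp (- (c * real n)))"
          using C_pos by (intro mult_left_mono) auto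
        finally show ?thesis .
      next
        case False
        have "real r * expn n (?Y r) \<le> real n / C * exp (- \<kappa>) ^ r"
          using elim(1) r1 by blast
        also have "exp (- \<kappa>) ^ r = exp (- (\<kappa> * real r))"
          by (simp add: exp_of_nat_mult[symmetric] mult.commute)
        also have "\<kappa> * real r \<ge> c * real n"
          using False \<kappa> by (simp add: c_def)
        then have "real n / C * exp (- (\<kappa> * real r)) \<le> real n / C * (q ^ r + exp (- (c * real n)))"
          using C_pos q by (intro mult_left_mono add_increasing) auto
        finally show ?thesis .
      qed
      finally show "prb n {G. 1 \<le> ?Y r G} \<le> real n / C * (q ^ r + exp (- (c * real n)))" .
    qed
    also have "\<dots> = real n / C * ((\<Sum>r\<in>{a..n div 2}. q ^ r) + real (card {a..n div 2}) * exp (- (c * real n)))"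
      by (simp only: sum_distrib_left[symmetric] sum.distrib sum_constant)
    also have "\<dots> \<le> ?B n"
    proof (intro mult_left_mono add_mono mult_right_mono)
      have "(\<Sum>r\<in>{a..n div 2}. q ^ r) \<le> q ^ a / (1 - q)" by (rule geometric_tail_le[OF q])
      also have "q ^ a = exp (- (\<delta>' * real a))"
        by (simp add: q_def exp_of_nat_mult[symmetric] mult.commute)
      also have "\<dots> \<le> exp (- (b * ln (real n)))"
        using mult_left_mono[OF a(2), of \<delta>'] \<delta>' by (simp add: b_def mult.assoc)
      finally show "(\<Sum>r\<in>{a..n div 2}. q ^ r) \<le> exp (- (b * ln (real n))) / (1 - q)"
        using q by (simp add: divide_right_mono)
      show "real (card {a..n div 2}) \<le> real n" using a(1) by simp
    qed (use C_pos in auto)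
    finally show ?case .
  qed
  then show ?thesis
    by (rule tendsto_sandwich[OF _ _ tendsto_const lim, rotated]) simp
qed

end

section \<open>The giant component\<close>

lemma sum_card_comps:
  assumes "\<And>e. G e \<Longrightarrow> e \<in> Kedges n"
  shows "(\<Sum>S\<in>comps n G. card S) = n"
proof -
  have sub: "S \<subseteq> {1..n}" if "S \<in> comps n G" for S
    using that comp_subset_vertices[OF assms] unfolding comps_def by blast
  have "(\<Sum>S\<in>comps n G. card S) = card (\<Union>(comps n G))"
  proof (rule card_Union_disjoint[symmetric])
    show "disjoint (comps n G)"
      using comps_disjoint unfolding disjoint_def by blast
    show "finite S" if "S \<in> comps n G" for S
      using sub[OF that] finite_subset by blast
  qed
  also have "\<Union>(comps n G) = {1..n}"
  proof (rule equalityI)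
    show "{1..n} \<subseteq> \<Union>(comps n G)" unfolding comps_def using comp_self by blast
  qed (use sub in blast)
  finally show ?thesis by simp
qed

text \<open>Components are grouped by size; the factor \<open>r\<close> makes the term of size 0
  vanish.\<close>

lemma sum_card_small_comps:
  "(\<Sum>S\<in>{S \<in> comps n G. card S \<le> n div 2}. card S) = (\<Sum>r\<in>{1..n div 2}. r * num_comps n r G)"
proof -
  let ?A = "{S \<in> comps n G. card S \<le> n div 2}"
  have "(\<Sum>S\<in>?A. card S) = (\<Sum>r\<in>{0..n div 2}. \<Sum>S\<in>{S \<in> ?A. card S = r}. card S)"
    by (rule sum.group[symmetric]) auto
  also have "\<dots> = (\<Sum>r\<in>{0..n div 2}. r * num_comps n r G)"
  proof (rule sum.cong[OF refl])
    fix r assume "r \<in> {0..n div 2}"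
    then have "{S \<in> ?A. card S = r} = {S \<in> comps n G. card S = r}" by auto
    then show "(\<Sum>S\<in>{S \<in> ?A. card S = r}. card S) = r * num_comps n r G"
      by (simp add: num_comps_def)
  qed
  also have "\<dots> = (\<Sum>r\<in>{1..n div 2}. r * num_comps n r G)"
    by (rule sum.mono_neutral_right) auto
  finally show ?thesis .
qed

text \<open>No component has between \<open>M ln n\<close> and \<open>n / 2\<close> vertices, and two disjoint components cannot
  both contain more than half of the vertices; so whatever lies outside the small components is a
  single component. If nothing does, then \<open>qC C\<close> is close to 1 and any vertex witnesses \<open>H3\<close>.\<close>

lemma H3I:
  assumes supp: "\<And>e. G e \<Longrightarrow> e \<in> Kedges n" and n: "1 \<le> n" and \<gamma>: "0 < \<gamma>"
    and gap: "\<And>r. M * ln (real n) < real r \<Longrightarrow> r \<le> n div 2 \<Longrightarrow> num_comps n r G = 0"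
    and near: "\<bar>(\<Sum>r\<in>{1..n div 2}. real r * real (num_comps n r G)) / real n - qC C\<bar> \<le> \<gamma> / 2"
    and ln: "M * ln (real n) \<le> \<gamma> / 2 * real n"
  shows "G \<in> H3 n C M \<gamma>"
proof -
  let ?small = "{S \<in> comps n G. card S \<le> n div 2}"
  let ?N = "\<Sum>S\<in>?small. card S"
  have N: "\<bar>real ?N - qC C * real n\<bar> \<le> \<gamma> / 2 * real n"
  proof -
    have "real ?N = (\<Sum>r\<in>{1..n div 2}. real r * real (num_comps n r G))"
      by (simp only: sum_card_small_comps of_nat_sum of_nat_mult)
    with near have "\<bar>real ?N / real n - qC C\<bar> \<le> \<gamma> / 2" by simp
    moreover have "real ?N - qC C * real n = (real ?N / real n - qC C) * real n"
      using n by (simp add: left_diff_distrib)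
    ultimately show ?thesis by (simp only: abs_mult abs_of_nat mult_right_mono of_nat_0_le_iff)
  qed
  have small: "real (card S) \<le> M * ln (real n)" if "S \<in> ?small" for S
  proof (rule ccontr)
    assume "\<not> real (card S) \<le> M * ln (real n)"
    then have "num_comps n (card S) G = 0" using gap[of "card S"] that by auto
    moreover have "S \<in> {T \<in> comps n G. card T = card S}" using that by simp
    ultimately show False unfolding num_comps_def by (simp add: card_eq_0_iff) blast
  qed
  have \<gamma>n: "0 \<le> \<gamma> * real n" using \<gamma> by simp
  have expand: "(1 - qC C - \<gamma>) * real n = real n - qC C * real n - \<gamma> * real n"
    "(1 - qC C + \<gamma>) * real n = real n - qC C * real n + \<gamma> * real n"
    "\<gamma> / 2 * real n = (\<gamma> * real n) / 2"
    by (simp_all add: algebra_simps)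
  have comp_in: "comp G j \<in> comps n G" if "j \<in> {1..n}" for j
    using that by (simp add: comps_def)
  show ?thesis
  proof (cases "comps n G = ?small")
    case True
    \<comment> \<open>The small components cover all vertices, so \<open>near\<close> forces
      \<open>1 - qC C\<close> to be within \<open>\<gamma> / 2\<close> of 0. The window of
      \<open>H3\<close> then contains every size from 0 to \<open>\<gamma> / 2 * n\<close>, and by
      \<open>ln\<close> the component of vertex 1 fits.\<close>
    then have "?N = n" using sum_card_comps[OF supp] by metis
    with N have q: "\<bar>real n - qC C * real n\<bar> \<le> \<gamma> / 2 * real n" by simp
    have one: "(1::nat) \<in> {1..n}" using n by simp
    have all: "real (card (comp G j)) \<le> M * ln (real n)" if "j \<in> {1..n}" for j
      using small comp_in[OF that] True by blast
    have b: "(1 - qC C - \<gamma>) * real n \<le> 0" "\<gamma> / 2 * real n \<le> (1 - qC C + \<gamma>) * real n"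
      using q \<gamma>n unfolding expand by linarith+
    have "(1 - qC C - \<gamma>) * real n \<le> real (card (comp G 1))"
      using b(1) by (rule order_trans) simp
    moreover have "real (card (comp G 1)) \<le> (1 - qC C + \<gamma>) * real n"
      using all[OF one] ln b(2) by linarith
    ultimately show ?thesis
      unfolding H3_def by (intro CollectI bexI[OF _ one] conjI ballI impI all)
  next
    case False
    then obtain L where L: "L \<in> comps n G" "n div 2 < card L" by fastforce
    have "S \<in> ?small" if S: "S \<in> comps n G" "S \<noteq> L" for S
    proof (rule ccontr)
      assume "S \<notin> ?small"
      then have "n div 2 < card S" using S by simp
      moreover have "card S + card L \<le> n"
      proof -
        have "(\<Sum>T\<in>{S, L}. card T) \<le> (\<Sum>T\<in>comps n G. card T)"
          using S L by (intro sum_mono2) auto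
        then show ?thesis using sum_card_comps[OF supp] S by simp
      qed
      \<comment> \<open>Both sets have at least \<open>n div 2 + 1\<close> vertices, which exceeds
        \<open>n\<close> in total even for odd \<open>n\<close>.\<close>
      ultimately show False using L by linarith
    qed
    then have eq: "comps n G = insert L ?small" using L by blast
    have "card L + ?N = n"
    proof -
      have "(\<Sum>S\<in>comps n G. card S) = card L + ?N"
        using L by (subst eq, subst sum.insert) auto
      then show ?thesis using sum_card_comps[OF supp] by simp
    qed
    then have cL: "real (card L) = real n - real ?N" by linarith
    obtain i where i: "i \<in> {1..n}" "comp G i = L" using L by (auto simp: comps_def)
    have "(1 - qC C - \<gamma>) * real n \<le> real (card L)" "real (card L) \<le> (1 - qC C + \<gamma>) * real n"
      using N \<gamma>n unfolding cL expand by linarith+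
    moreover have "real (card (comp G j)) \<le> M * ln (real n)" if "j \<in> {1..n}" "comp G j \<noteq> L" for j
      using small comp_in[OF that(1)] that(2) eq by blast
    ultimately show ?thesis
      unfolding H3_def by (intro CollectI bexI[OF _ i(1)]) (auto simp: i(2))
  qed
qed

text \<open>Three kinds of bad event get probability at most \<open>\<gamma> / 4\<close> each.
  Outside them, truncating the series of \<open>qC C\<close>, the counts of sizes up to
  \<open>R\<close> and the vertices in sizes from \<open>R + 1\<close> to \<open>n / 2\<close> each
  cost at most \<open>\<gamma> / 8\<close>, within the \<open>\<gamma> / 2\<close> allowed by
  \<open>H3I\<close>.\<close>

lemma (in sparse_graph) prob_H3_ge:
  assumes \<eta>: "0 < C / 2 - 1 - ln C" and \<delta>: "0 < C - 1 - ln C" and M: "1 / (C - 1 - ln C) < M"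
    and \<gamma>: "0 < \<gamma>"
  shows "\<forall>\<^sub>F n in sequentially. 1 - \<gamma> \<le> prb n (H3 n C M \<gamma>)"
proof -
  let ?w = "\<lambda>r. real r * comp_density C r"
  have "(\<lambda>R. \<Sum>k<R. ?w (Suc k)) \<longlonglongrightarrow> qC C"
    using qC_sums[OF C_pos \<delta>] by (simp only: sums_def)
  then have "\<forall>\<^sub>F R in sequentially. \<bar>(\<Sum>k<R. ?w (Suc k)) - qC C\<bar> < \<gamma> / 8"
    using \<gamma> unfolding tendsto_iff dist_real_def by (meson zero_less_divide_iff zero_less_numeral)
  \<comment> \<open>\<open>R\<close> is fixed before \<open>n\<close>: concentration holds for each
    size separately, hence jointly for finitely many sizes.\<close>
  then have "\<forall>\<^sub>F R in sequentially. \<bar>(\<Sum>k<R. ?w (Suc k)) - qC C\<bar> < \<gamma> / 8 \<and> 1 \<le> R \<and>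
      (\<forall>\<^sub>F n in sequentially. prb n {G. \<gamma> / 8 * real n \<le>
        (\<Sum>r\<in>{Suc R..n div 2}. real r * real (num_comps n r G))} \<le> \<gamma> / 4)"
    using \<gamma> by (intro eventually_conj few_vertices_in_large_small_comps[OF \<eta>] eventually_ge_at_top) auto
  then obtain R where R: "\<bar>(\<Sum>k<R. ?w (Suc k)) - qC C\<bar> < \<gamma> / 8" "1 \<le> R"
      "\<forall>\<^sub>F n in sequentially. prb n {G. \<gamma> / 8 * real n \<le>
        (\<Sum>r\<in>{Suc R..n div 2}. real r * real (num_comps n r G))} \<le> \<gamma> / 4"
    using eventually_happens[of _ "sequentially"] by (metis (no_types, lifting) sequentially_bot)
  \<comment> \<open>\<open>R\<close> sizes, each weighted by at most \<open>R\<close>: an error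
    \<open>\<epsilon>\<close> per size costs at most
    \<open>R * R * \<epsilon> = \<gamma> / 8\<close>.\<close>
  define \<epsilon> where "\<epsilon> = \<gamma> / (8 * real R * real R)"
  have \<epsilon>: "0 < \<epsilon>" "real R * (real R * \<epsilon>) = \<gamma> / 8" using \<gamma> R(2) by (simp_all add: \<epsilon>_def)
  let ?B1 = "\<lambda>n. {G. \<exists>r. M * ln (real n) < real r \<and> r \<le> n div 2 \<and> num_comps n r G \<noteq> 0}"
  let ?B2 = "\<lambda>n r. {G. \<epsilon> \<le> \<bar>real (num_comps n r G) / real n - comp_density C r\<bar>}"
  let ?B3 = "\<lambda>n. {G. \<gamma> / 8 * real n \<le> (\<Sum>r\<in>{Suc R..n div 2}. real r * real (num_comps n r G))}"
  have "\<forall>\<^sub>F n in sequentially. prb n (?B1 n) < \<gamma> / 4"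
    using no_medium_comps[OF \<eta> \<delta> M] \<gamma> by (intro order_tendstoD(2)) auto
  moreover have "\<forall>\<^sub>F n in sequentially. (\<Sum>r\<in>{1..R}. prb n (?B2 n r)) < \<gamma> / 4"
  proof -
    have "(\<lambda>n. \<Sum>r\<in>{1..R}. prb n (?B2 n r)) \<longlonglongrightarrow> (\<Sum>r\<in>{1..R}. 0)"
      using \<epsilon> by (intro tendsto_sum num_comps_concentrated) auto
    then show ?thesis using \<gamma> by (intro order_tendstoD(2)) auto
  qed
  moreover note R(3)
  moreover have "\<forall>\<^sub>F n in sequentially. M * ln (real n) \<le> \<gamma> / 2 * real n"
  proof -
    have "(\<lambda>n::nat. M * (ln (real n) / real n)) \<longlonglongrightarrow> M * 0"
      by (intro tendsto_intros)
    then have "\<forall>\<^sub>F n in sequentially. M * (ln (real n) / real n) < \<gamma> / 2"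
      using \<gamma> by (intro order_tendstoD(2)) auto
    with eventually_gt_at_top[of 0] show ?thesis
      by eventually_elim (simp add: field_simps)
  qed
  moreover note eventually_ge_at_top[of "2 * R"]
  ultimately show ?thesis
  proof eventually_elim
    case (elim n)
    have n: "1 \<le> n" "R \<le> n div 2" using elim R(2) by auto
    let ?B = "?B1 n \<union> (\<Union>r\<in>{1..R}. ?B2 n r) \<union> ?B3 n"
    \<comment> \<open>On the support, avoiding all bad events forces \<open>H3\<close>, so the union
      has probability 1.\<close>
    have "prb n UNIV \<le> prb n (H3 n C M \<gamma> \<union> ?B)"
    proof (rule prob_mono_support)
      fix G assume G: "G \<in> set_pmf (rgraph n (p n))"
      show "G \<in> H3 n C M \<gamma> \<union> ?B"
      proof (rule ccontr)
        assume not: "G \<notin> H3 n C M \<gamma> \<union> ?B"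
        let ?y = "\<lambda>r. real r * real (num_comps n r G)"
        have "(\<Sum>r\<in>{1..n div 2}. ?y r) = (\<Sum>r\<in>{1..R}. ?y r) + (\<Sum>r\<in>{Suc R..n div 2}. ?y r)"
          using n(2) sum.ub_add_nat[of 1 R ?y "n div 2 - R"] by simp
        moreover have "(\<Sum>r\<in>{Suc R..n div 2}. ?y r) / real n < \<gamma> / 8"
          using not n(1) by (simp add: divide_less_eq)
        moreover have "0 \<le> (\<Sum>r\<in>{Suc R..n div 2}. ?y r) / real n"
          by (intro divide_nonneg_nonneg sum_nonneg) auto
        moreover have "\<bar>(\<Sum>r\<in>{1..R}. ?y r) / real n - (\<Sum>r\<in>{1..R}. ?w r)\<bar> \<le> \<gamma> / 8"
        proof -
          have "(\<Sum>r\<in>{1..R}. ?y r) / real n - (\<Sum>r\<in>{1..R}. ?w r) =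
              (\<Sum>r\<in>{1..R}. real r * (real (num_comps n r G) / real n - comp_density C r))"
            by (simp add: sum_divide_distrib sum_subtractf right_diff_distrib)
          also have "\<bar>\<dots>\<bar> \<le> (\<Sum>r\<in>{1..R}. \<bar>real r * (real (num_comps n r G) / real n - comp_density C r)\<bar>)"
            by (rule sum_abs)
          also have "\<dots> \<le> (\<Sum>r\<in>{1..R}. real R * \<epsilon>)"
          proof (rule sum_mono)
            fix r assume r: "r \<in> {1..R}"
            then have "G \<notin> ?B2 n r" using not by blast
            then have "\<bar>real (num_comps n r G) / real n - comp_density C r\<bar> \<le> \<epsilon>" by simp
            then show "\<bar>real r * (real (num_comps n r G) / real n - comp_density C r)\<bar> \<le> real R * \<epsilon>"
              unfolding abs_mult using r by (intro mult_mono) auto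
          qed
          also have "\<dots> = \<gamma> / 8" using \<epsilon>(2) by simp
          finally show ?thesis .
        qed
        moreover have "(\<Sum>r\<in>{1..R}. ?w r) = (\<Sum>k<R. ?w (Suc k))"
          by (rule sum.reindex_bij_witness[of _ Suc "\<lambda>r. r - 1"]) auto
        ultimately have "\<bar>(\<Sum>r\<in>{1..n div 2}. ?y r) / real n - qC C\<bar> \<le> \<gamma> / 2"
          using R(1) \<gamma> by (simp only: add_divide_distrib)
        moreover have "num_comps n r G = 0" if "M * ln (real n) < real r" "r \<le> n div 2" for r
          using not that by blast
        ultimately have "G \<in> H3 n C M \<gamma>"
          using rgraph_support[OF G] n(1) \<gamma> elim by (intro H3I) auto
        with not show False by blast
      qed
    qed
    also have "\<dots> \<le> prb n (H3 n C M \<gamma>) + prb n ?B"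
      by (rule measure_Un_le) auto
    also have "prb n ?B \<le> prb n (?B1 n \<union> (\<Union>r\<in>{1..R}. ?B2 n r)) + prb n (?B3 n)"
      by (rule measure_Un_le) auto
    also have "prb n (?B1 n \<union> (\<Union>r\<in>{1..R}. ?B2 n r)) \<le> prb n (?B1 n) + prb n (\<Union>r\<in>{1..R}. ?B2 n r)"
      by (rule measure_Un_le) auto
    also have "prb n (\<Union>r\<in>{1..R}. ?B2 n r) \<le> (\<Sum>r\<in>{1..R}. prb n (?B2 n r))"
      by (intro measure_pmf.finite_measure_subadditive_finite) auto
    finally have "1 \<le> prb n (H3 n C M \<gamma>) + (prb n (?B1 n) + (\<Sum>r\<in>{1..R}. prb n (?B2 n r)) + prb n (?B3 n))"
      by simp
    then show ?case using elim \<gamma> by linarith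
  qed
qed

section \<open>The constant \<open>C0\<close> and the conclusion\<close>

text \<open>A root above 1 exceeds 2, since \<open>ln x > 0\<close> there; and beyond 2 the slope \<open>1/2 - 1/x\<close> is positive.\<close>

lemma half_minus_ln_root:
  fixes x y :: real
  assumes "1 < x" "x / 2 - 1 - ln x = 0"
  shows "2 < x" and "x < y \<Longrightarrow> 0 < y / 2 - 1 - ln y"
proof -
  show x: "2 < x" using ln_gt_zero[OF assms(1)] assms(2) by linarith
  assume y: "x < y"
  have "ln y - ln x = ln (y / x)" using x y by (simp add: ln_div)
  also have "\<dots> \<le> y / x - 1" using x y by (intro ln_le_minus_one) simp
  also have "\<dots> = (y - x) / x" using x by (simp add: diff_divide_distrib)
  also have "\<dots> < (y - x) / 2" using x y by (intro divide_strict_left_mono) auto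
  finally show "0 < y / 2 - 1 - ln y" using assms(2) by (simp add: diff_divide_distrib)
qed

theorem theorem5:
  shows "\<exists>C0::real. C0 > 1 \<and> C0 / 2 - 1 - ln C0 = 0 \<and>
           (\<forall>C'. C' > 1 \<and> C' / 2 - 1 - ln C' = 0 \<longrightarrow> C' = C0) \<and>
           C0 < 8 \<and>
           (\<forall>C::real. C > C0 \<longrightarrow> C - 1 - ln C > 0) \<and>
           (\<forall>C M a \<gamma> :: real. \<forall>as :: nat \<Rightarrow> real. \<forall>p :: nat \<Rightarrow> nat set \<Rightarrow> real.
              C > C0 \<longrightarrow> M > 1 / (C - 1 - ln C) \<longrightarrow> a > 0 \<longrightarrow>
              (C - 1 - ln C) - C * (a + 1/2) > 0 \<longrightarrow> 0 < \<gamma> \<longrightarrow> \<gamma> < 1 \<longrightarrow>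
              (\<forall>n. as n \<ge> 0) \<longrightarrow> as \<longlonglongrightarrow> 0 \<longrightarrow>
              (\<forall>n\<ge>1. \<forall>e\<in>Kedges n. 0 \<le> p n e \<and> p n e \<le> 1 \<and>
                   (C - as n) / real n \<le> p n e \<and> p n e \<le> (C + as n) / real n) \<longrightarrow>
              (\<exists>L4>0. \<forall>n. real n \<ge> L4 \<longrightarrow>
                 measure_pmf.prob (rgraph n (p n)) (H3 n C M \<gamma>) \<ge> 1 - exp (- a * C) - \<gamma>))"
proof -
  let ?f = "\<lambda>x::real. x / 2 - 1 - ln x"
  \<comment> \<open>As \<open>ln 2 < 1\<close>, \<open>ln 8 < 3 = 8 / 2 - 1\<close>, so
    \<open>?f\<close> is positive at 8; it equals \<open>- ln 2\<close> at 2, and a root lies in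
    between.\<close>
  have "ln (8::real) = 3 * ln 2" using ln_realpow[of 2 3] by simp
  then have f8: "0 < ?f 8" using ln_2_less_1 by simp
  have "\<exists>x\<ge>2. x \<le> 8 \<and> ?f x = 0"
    using f8 by (intro IVT') (auto intro!: continuous_intros)
  then obtain C0 where C0: "2 \<le> C0" "C0 \<le> 8" "?f C0 = 0" by blast
  have gt: "1 < C0" using C0 by simp
  have lt8: "C0 < 8" using C0 f8 by (cases "C0 = 8") auto
  \<comment> \<open>\<open>?f\<close> is positive beyond any root above 1, so the larger of two
    distinct roots could not be a root.\<close>
  have uniq: "C' = C0" if "1 < C'" "?f C' = 0" for C'
    using half_minus_ln_root(2)[OF that, of C0] half_minus_ln_root(2)[OF gt C0(3), of C'] C0(3) that
    by (cases C' C0 rule: linorder_cases) auto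
  have \<eta>: "0 < ?f C" if "C0 < C" for C
    using half_minus_ln_root(2)[OF gt C0(3) that] .
  have \<delta>: "0 < C - 1 - ln C" if "C0 < C" for C
    using \<eta>[OF that] that gt by linarith
  have main: "\<exists>L4>0. \<forall>n. real n \<ge> L4 \<longrightarrow>
      measure_pmf.prob (rgraph n (p n)) (H3 n C M \<gamma>) \<ge> 1 - exp (- a * C) - \<gamma>"
    if *: "C0 < C" "1 / (C - 1 - ln C) < M" "0 < \<gamma>" "\<forall>n. as n \<ge> 0" "as \<longlonglongrightarrow> 0"
      "\<forall>n\<ge>1. \<forall>e\<in>Kedges n. 0 \<le> p n e \<and> p n e \<le> 1 \<and>
        (C - as n) / real n \<le> p n e \<and> p n e \<le> (C + as n) / real n"
    for C M a \<gamma> :: real and as :: "nat \<Rightarrow> real" and p :: "nat \<Rightarrow> nat set \<Rightarrow> real"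
  proof -
    interpret sparse_graph C as p
      using * gt by unfold_locales auto
    obtain N where N: "\<And>n. N \<le> n \<Longrightarrow> 1 - \<gamma> \<le> prb n (H3 n C M \<gamma>)"
      using prob_H3_ge[OF \<eta>[OF *(1)] \<delta>[OF *(1)] *(2) *(3)] unfolding eventually_sequentially by blast
    show ?thesis
    proof (intro exI[of _ "real (max 1 N)"] conjI allI impI)
      fix n assume "real (max 1 N) \<le> real n"
      then have "1 - \<gamma> \<le> prb n (H3 n C M \<gamma>)" by (intro N) simp
      \<comment> \<open>The bound \<open>1 - \<gamma>\<close> implies the claim because the
        exponential is positive.\<close>
      then show "1 - exp (- a * C) - \<gamma> \<le> prb n (H3 n C M \<gamma>)"
        using exp_gt_zero[of "- a * C"] by linarith
    qed simp
  qed
  show ?thesis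
    by (rule exI[of _ C0], intro conjI allI impI)
      (rule gt C0(3) lt8 | erule \<delta> | (elim conjE, rule uniq; assumption) | (rule main; assumption))+
qed

end
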